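(* Consider the Spike-and-Slab prior on $\mathbb{R}^p$ $$\pi(\beta)=\sum_{s=0}^{p}\pi(s)\sum_{S\subset\{1,\dots,p\}:|S|=s}\binom{p}{s}^{-1}\pi_{S,\lambda}(\beta_S)\otimes\bigotimes_{i\notin S}\delta_0(\beta_i),\qquad \pi_{S,\lambda}(\beta_S)=(\lambda/2)^{|S|}e^{-\lambda\|\beta_S\|_1},$$ with $\lambda=\sqrt n/p$, where for some constants $A_1,A_2,A_3,A_4>0$ with $A_4>2$ $$A_1p^{-A_3}\pi(s-1)\le\pi(s)\le A_2p^{-A_4}\pi(s-1),\qquad s=1,\dots,p.$$ Let $\hat p(\tilde Y\mid Y)$ be the corresponding posterior predictive density. Suppose that the Design Assumption (stated in the context, with constants $0<b<1$ and $d>0$) holds and that $s_n\le n=o(p/\sqrt{\log p})$. Set $$\mu_n=s_n\left[(\log p)^{(d-1)\vee1}\vee\log(1+m/n)\right].$$ Then for some suitable $M>0$ and any $c_0>0$, $$\sup_{\beta_0\in\tilde\Theta(s_n,M):\ \phi(S_0)\wedge\tilde\psi(S_0)\ge c_0}\left[\rho^{TV}_{n,m}(\beta_0,\hat p)\right]^2\lesssim\mu_n$$ and $$\sup_{\beta_0\in\tilde\Theta(s_n,M):\ \phi(S_0)\wedge\tilde\psi(S_0)\ge c_0}\mathbb{P}_{Y\mid\beta_0}\left(KL\big(\pi(\tilde Y\mid\beta_0),\hat p(\tilde Y\mid Y)\big)\gtrsim\mu_n\right)=o(1).$$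
   Context: Model: $Y=X\beta_0+\varepsilon$, $\varepsilon\sim N_n(0,I)$, with $X$ an $n\times p$ matrix, $p>n$; to be predicted is $\tilde Y=\tilde X\beta_0+\tilde\varepsilon$, $\tilde\varepsilon\sim N_m(0,I)$, with $\tilde X$ an $m\times p$ matrix; $Y$ and $\tilde Y$ are independent given $\beta_0\in\mathbb{R}^p$. Columns are normalized: $\|X^j\|_2=\sqrt n$, $\|\tilde X^j\|_2=\sqrt m$ for all $j$; $\|X\|=\max_{1\le j\le p}\|X^j\|_2$. $\pi(Y\mid\beta)$ and $\pi(\tilde Y\mid\beta)$ are the $N_n(X\beta,I)$ and $N_m(\tilde X\beta,I)$ densities. For $\beta\in\mathbb{R}^p$, $S_\beta=\{i:\beta_i\ne0\}$ and $\beta_S=(\beta_i)_{i\in S}$; $S_0=S_{\beta_0}$, $s_0=|S_0|$; $X_S$ is the submatrix of columns of $X$ in $S$, $X_0=X_{S_0}$; $\|\beta\|_0=|S_\beta|$; $\delta_0$ is the point mass at zero. Predictive density: $\hat p(\tilde Y\mid Y)=\int\pi(\tilde Y\mid\beta)\,\pi(d\beta\mid Y)$, with $\pi(d\beta\mid Y)$ the posterior. $\rho^{TV}_{n,m}(\beta_0,\hat p)=\mathbb{E}_{Y\mid\beta_0}\|\pi(\cdot\mid\beta_0)-\hat p(\cdot\mid Y)\|_{TV}$ (densities of $\tilde Y$), and $KL(f,g)=\int f\log(f/g)$. Compatibility number: $\phi(S)=\inf\left\{\frac{\|X\beta\|_2|S|^{1/2}}{\|X\|\,\|\beta_S\|_1}:\|\beta_{S^c}\|_1\le7\|\beta_S\|_1,\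 \beta_S\ne0\right\}$. Smallest scaled singular value: $\tilde\phi(s)=\inf\left\{\frac{\|X\beta\|_2}{\|X\|\,\|\beta\|_2}:0\ne|S_\beta|\le s\right\}$. With $\bar\lambda=2\|X\|\sqrt{\log p}$, $\tilde\psi(S)=\tilde\phi\left(\left(2+\frac{3}{A_4}+\frac{33}{\phi(S)^2}\frac{\lambda}{\bar\lambda}\right)|S|\right)$. Beta-min class: $\tilde\Theta(s_n,M)=\left\{\beta_0\in\mathbb{R}^p:\|\beta_0\|_0\le s_n,\ \inf_{i\in S_0}|\beta_{0i}|\ge\beta_{min}\right\}$ with $\beta_{min}=\frac{M}{\tilde\psi(S_0)^2}\frac{\sqrt{|S_0|\log p}}{\|X\|\phi(S_0)}$. Design Assumption: $\|X_0\|=\sqrt n$ and for some $0<b<1$ and $d>0$, $$\frac{4\,\chi^2_{s_0,1/2}}{(1-b)^2\beta_{min}^2}<\lambda_{min}(X_0'X_0)<\lambda_{max}(X_0'X_0)\lesssim n(\log p)^d,$$ where $\chi^2_{s_0,1/2}$ is the median of the chi-squared distribution with $s_0$ degrees of freedom and $\lambda_{min},\lambda_{max}$ are the extreme eigenvalues. $A\lesssim B$ (resp. $A\gtrsim B$) means $A\le CB$ (resp. $A\ge CB$) for some universal constant $C>0$. Asymptotics are as $n\to\infty$ with $p$, $s_n$ allowed to grow with $n$. *)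

theory Defs
  imports
    "HOL-Probability.Probability"
    "Jordan_Normal_Form.Char_Poly"
    "Jordan_Normal_Form.DL_Submatrix"
begin

text \<open>
  Dimensions vary with the sample size, so a vector in k-dimensional space is a function on the
  naturals of which only the values on \<open>{..<k}\<close> matter, and probability laws live on
  \<open>PiM {..<k}\<close>.  Design matrices are matrices with explicit dimensions; \<open>dim_col X\<close> is the number of
  parameters.
\<close>

section \<open>Design matrices and sparsity\<close>

definition supp :: "real mat \<Rightarrow> (nat \<Rightarrow> real) \<Rightarrow> nat set" where
  "supp X \<beta> = {i. i < dim_col X \<and> \<beta> i \<noteq> 0}"

definition mean_vec :: "real mat \<Rightarrow> (nat \<Rightarrow> real) \<Rightarrow> nat \<Rightarrow> real" where
  "mean_vec X \<beta> = vec_index (X *\<^sub>v Matrix.vec (dim_col X) \<beta>)"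

definition l2norm :: "nat \<Rightarrow> (nat \<Rightarrow> real) \<Rightarrow> real" where
  "l2norm k v = L2_set v {..<k}"

definition col_norm :: "real mat \<Rightarrow> nat \<Rightarrow> real" where
  "col_norm X j = l2norm (dim_row X) (vec_index (col X j))"

definition mat_norm :: "real mat \<Rightarrow> real" where
  "mat_norm X = Max (col_norm X ` {..<dim_col X})"

definition columns :: "real mat \<Rightarrow> nat set \<Rightarrow> real mat" where
  "columns X S = submatrix X UNIV S"

definition eig_min :: "real mat \<Rightarrow> real" where
  "eig_min A = Min {k. eigenvalue A k}"

definition eig_max :: "real mat \<Rightarrow> real" where
  "eig_max A = Max {k. eigenvalue A k}"

text \<open>
  Infima are taken in \<^typ>\<open>ereal\<close>: an infimum over the empty set (which occurs only for the empty
  support) is infinite, and \<open>33 / 0 = \<infinity>\<close>, \<open>33 / \<infinity> = 0\<close>, \<open>\<infinity> * 0 = 0\<close>.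
\<close>

definition compat :: "real mat \<Rightarrow> nat set \<Rightarrow> ereal" where
  "compat X S = (INF \<beta>\<in>{\<beta>. (\<Sum>i\<in>{..<dim_col X} - S. \<bar>\<beta> i\<bar>) \<le> 7 * (\<Sum>i\<in>S. \<bar>\<beta> i\<bar>) \<and> (\<exists>i\<in>S. \<beta> i \<noteq> 0)}.
     ereal (l2norm (dim_row X) (mean_vec X \<beta>) * sqrt (card S) / (mat_norm X * (\<Sum>i\<in>S. \<bar>\<beta> i\<bar>))))"

definition scaled_sing :: "real mat \<Rightarrow> ereal \<Rightarrow> ereal" where
  "scaled_sing X t = (INF \<beta>\<in>{\<beta>. card (supp X \<beta>) \<noteq> 0 \<and> ereal (card (supp X \<beta>)) \<le> t}.
     ereal (l2norm (dim_row X) (mean_vec X \<beta>) / (mat_norm X * l2norm (dim_col X) \<beta>)))"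

definition lambda_bar :: "real mat \<Rightarrow> real" where
  "lambda_bar X = 2 * mat_norm X * sqrt (ln (dim_col X))"

definition psi_tilde :: "real \<Rightarrow> real \<Rightarrow> real mat \<Rightarrow> nat set \<Rightarrow> ereal" where
  "psi_tilde A4 lam X S =
     scaled_sing X ((2 + ereal (3 / A4) + 33 / (compat X S)\<^sup>2 * ereal (lam / lambda_bar X)) * ereal (card S))"

definition beta_min :: "real \<Rightarrow> real \<Rightarrow> real \<Rightarrow> real mat \<Rightarrow> nat set \<Rightarrow> ereal" where
  "beta_min A4 lam M X S =
     ereal M / (psi_tilde A4 lam X S)\<^sup>2 *
     (ereal (sqrt (card S * ln (dim_col X))) / (ereal (mat_norm X) * compat X S))"

definition beta_min_class :: "real \<Rightarrow> real \<Rightarrow> real \<Rightarrow> real mat \<Rightarrow> nat \<Rightarrow> (nat \<Rightarrow> real) set" where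
  "beta_min_class A4 lam M X s =
     {\<beta>. card (supp X \<beta>) \<le> s \<and>
         beta_min A4 lam M X (supp X \<beta>) \<le> (INF i\<in>supp X \<beta>. ereal \<bar>\<beta> i\<bar>)}"


section \<open>Gaussian laws\<close>

definition lebesgue_prod :: "nat \<Rightarrow> (nat \<Rightarrow> real) measure" where
  "lebesgue_prod k = PiM {..<k} (\<lambda>_. lborel)"

definition gauss_density :: "nat \<Rightarrow> (nat \<Rightarrow> real) \<Rightarrow> (nat \<Rightarrow> real) \<Rightarrow> real" where
  "gauss_density k \<mu> y = (\<Prod>i<k. normal_density (\<mu> i) 1 (y i))"

definition gauss_measure :: "nat \<Rightarrow> (nat \<Rightarrow> real) \<Rightarrow> (nat \<Rightarrow> real) measure" where
  "gauss_measure k \<mu> = density (lebesgue_prod k) (\<lambda>y. ennreal (gauss_density k \<mu> y))"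

text \<open>The law of the data (or its density) given the regression vector, for a design \<open>X\<close>.\<close>

definition model_density :: "real mat \<Rightarrow> (nat \<Rightarrow> real) \<Rightarrow> (nat \<Rightarrow> real) \<Rightarrow> real" where
  "model_density X \<beta> = gauss_density (dim_row X) (mean_vec X \<beta>)"

definition model :: "real mat \<Rightarrow> (nat \<Rightarrow> real) \<Rightarrow> (nat \<Rightarrow> real) measure" where
  "model X \<beta> = gauss_measure (dim_row X) (mean_vec X \<beta>)"

definition chi_square_median :: "nat \<Rightarrow> real" where
  "chi_square_median k =
     Inf {q. 1 / 2 \<le> \<P>(z in gauss_measure k (\<lambda>_. 0). (\<Sum>i<k. (z i)\<^sup>2) \<le> q)}"

definition design_assumption ::
  "real \<Rightarrow> real \<Rightarrow> real \<Rightarrow> real \<Rightarrow> real \<Rightarrow> real \<Rightarrow> real mat \<Rightarrow> (nat \<Rightarrow> real) \<Rightarrow> bool" where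
  "design_assumption b d K A4 lam M X \<beta> \<longleftrightarrow>
     (let S = supp X \<beta>; X0 = columns X S; G = transpose_mat X0 * X0 in
       mat_norm X0 = sqrt (dim_row X) \<and>
       ereal (4 * chi_square_median (card S)) / (ereal ((1 - b)\<^sup>2) * (beta_min A4 lam M X S)\<^sup>2)
         < ereal (eig_min G) \<and>
       eig_min G < eig_max G \<and>
       eig_max G \<le> K * (real (dim_row X) * ln (dim_col X) powr d))"


section \<open>Spike-and-slab prior, posterior and predictive density\<close>

definition slab :: "real \<Rightarrow> nat set \<Rightarrow> (nat \<Rightarrow> real) measure" where
  "slab lam S = density (PiM S (\<lambda>_. lborel))
     (\<lambda>\<beta>. ennreal ((lam / 2) ^ card S * exp (- lam * (\<Sum>i\<in>S. \<bar>\<beta> i\<bar>))))"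

definition spike_slab_component :: "nat \<Rightarrow> real \<Rightarrow> nat set \<Rightarrow> (nat \<Rightarrow> real) measure" where
  "spike_slab_component p lam S =
     distr (slab lam S \<Otimes>\<^sub>M PiM ({..<p} - S) (\<lambda>_. return borel 0))
       (PiM {..<p} (\<lambda>_. borel)) (merge S ({..<p} - S))"

definition spike_slab :: "nat \<Rightarrow> real \<Rightarrow> (nat \<Rightarrow> real) \<Rightarrow> (nat \<Rightarrow> real) measure" where
  "spike_slab p lam w =
     measure_of (space (PiM {..<p} (\<lambda>_. borel))) (sets (PiM {..<p} (\<lambda>_. borel)))
       (\<lambda>A. \<Sum>s\<le>p. ennreal (w s) *
          (\<Sum>S | S \<subseteq> {..<p} \<and> card S = s.
             ennreal (1 / real (p choose s)) * emeasure (spike_slab_component p lam S) A))"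

lemma sets_spike_slab [simp, measurable_cong]:
  "sets (spike_slab p lam w) = sets (PiM {..<p} (\<lambda>_. borel))"
  by (simp add: spike_slab_def)

lemma space_spike_slab [simp]:
  "space (spike_slab p lam w) = space (PiM {..<p} (\<lambda>_. borel))"
  by (simp add: spike_slab_def)

lemma sets_spike_slab_component [simp]:
  "sets (spike_slab_component p lam S) = sets (PiM {..<p} (\<lambda>_. borel))"
  by (simp add: spike_slab_component_def)

lemma emeasure_spike_slab:
  assumes "A \<in> sets (PiM {..<p} (\<lambda>_. borel))"
  shows "emeasure (spike_slab p lam w) A =
    (\<Sum>s\<le>p. ennreal (w s) * (\<Sum>S | S \<subseteq> {..<p} \<and> card S = s.
       ennreal (1 / real (p choose s)) * emeasure (spike_slab_component p lam S) A))"
proof (rule emeasure_measure_of[OF spike_slab_def])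
  let ?B = "sets (PiM {..<p} (\<lambda>_. borel :: real measure))"
  let ?f = "\<lambda>A. \<Sum>s\<le>p. ennreal (w s) * (\<Sum>S | S \<subseteq> {..<p} \<and> card S = s.
       ennreal (1 / real (p choose s)) * emeasure (spike_slab_component p lam S) A)"
  show "?B \<subseteq> Pow (space (PiM {..<p} (\<lambda>_. borel)))"
    by (rule sets.space_closed)
  show "positive (sets (spike_slab p lam w)) ?f"
    by (simp add: positive_def)
  show "countably_additive (sets (spike_slab p lam w)) ?f"
  proof (rule countably_additiveI)
    fix F :: "nat \<Rightarrow> (nat \<Rightarrow> real) set"
    assume F: "range F \<subseteq> sets (spike_slab p lam w)" "disjoint_family F"
    have sm: "(\<Sum>i. emeasure (spike_slab_component p lam S) (F i)) =
        emeasure (spike_slab_component p lam S) (\<Union>i. F i)" for S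
      using F by (intro suminf_emeasure) auto
    show "(\<Sum>i. ?f (F i)) = ?f (\<Union>i. F i)"
      by (simp add: suminf_sum ennreal_suminf_cmult sm)
  qed
  show "A \<in> sets (spike_slab p lam w)" using assms by simp
qed

definition posterior :: "real mat \<Rightarrow> (nat \<Rightarrow> real) measure \<Rightarrow> (nat \<Rightarrow> real) \<Rightarrow> (nat \<Rightarrow> real) measure" where
  "posterior X \<pi> Y = density \<pi> (\<lambda>\<beta>. ennreal (model_density X \<beta> Y) /
     (\<integral>\<^sup>+\<beta>'. ennreal (model_density X \<beta>' Y) \<partial>\<pi>))"

definition pred_density ::
  "real mat \<Rightarrow> real mat \<Rightarrow> (nat \<Rightarrow> real) measure \<Rightarrow> (nat \<Rightarrow> real) \<Rightarrow> (nat \<Rightarrow> real) \<Rightarrow> real" where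
  "pred_density X Xt \<pi> Y y = (\<integral>\<beta>. model_density Xt \<beta> y \<partial>posterior X \<pi> Y)"


section \<open>Losses\<close>

text \<open>Total variation normalised as the supremum of the difference over events.\<close>

definition tv_dist :: "'a measure \<Rightarrow> ('a \<Rightarrow> real) \<Rightarrow> ('a \<Rightarrow> real) \<Rightarrow> ennreal" where
  "tv_dist N f g = (\<integral>\<^sup>+x. ennreal \<bar>f x - g x\<bar> \<partial>N) / 2"

text \<open>
  The integral of \<open>f log (f / g)\<close> as an extended real.  The Bochner integral behind
  \<^const>\<open>KL_divergence\<close> is 0 for a divergent integral, which would turn infinite divergence into none.
\<close>

definition kl_integrand :: "('a \<Rightarrow> real) \<Rightarrow> ('a \<Rightarrow> real) \<Rightarrow> 'a \<Rightarrow> ereal" where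
  "kl_integrand f g x =
     (if f x = 0 then 0 else if g x = 0 then \<infinity> else ereal (f x * ln (f x / g x)))"

definition kl_div :: "'a measure \<Rightarrow> ('a \<Rightarrow> real) \<Rightarrow> ('a \<Rightarrow> real) \<Rightarrow> ereal" where
  "kl_div N f g =
     enn2ereal (\<integral>\<^sup>+x. e2ennreal (kl_integrand f g x) \<partial>N) -
     enn2ereal (\<integral>\<^sup>+x. e2ennreal (- kl_integrand f g x) \<partial>N)"

definition tv_risk :: "real mat \<Rightarrow> real mat \<Rightarrow> (nat \<Rightarrow> real) measure \<Rightarrow> (nat \<Rightarrow> real) \<Rightarrow> ennreal" where
  "tv_risk X Xt \<pi> \<beta>0 =
     (\<integral>\<^sup>+Y. tv_dist (lebesgue_prod (dim_row Xt)) (model_density Xt \<beta>0) (pred_density X Xt \<pi> Y) \<partial>model X \<beta>0)"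

definition kl_loss ::
  "real mat \<Rightarrow> real mat \<Rightarrow> (nat \<Rightarrow> real) measure \<Rightarrow> (nat \<Rightarrow> real) \<Rightarrow> (nat \<Rightarrow> real) \<Rightarrow> ereal" where
  "kl_loss X Xt \<pi> \<beta>0 Y =
     kl_div (lebesgue_prod (dim_row Xt)) (model_density Xt \<beta>0) (pred_density X Xt \<pi> Y)"


section \<open>Parameter sets and rate\<close>

text \<open>
  The design assumption constrains the true parameter, since it involves the support and
  \<^const>\<open>beta_min\<close>; it is void when there are no active columns.
\<close>

definition param_set ::
  "real \<Rightarrow> real \<Rightarrow> real \<Rightarrow> real \<Rightarrow> real \<Rightarrow> real \<Rightarrow> real \<Rightarrow> real mat \<Rightarrow> nat \<Rightarrow> (nat \<Rightarrow> real) set" where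
  "param_set b d K A4 lam M c0 X s =
     {\<beta>0 \<in> beta_min_class A4 lam M X s.
        ereal c0 \<le> min (compat X (supp X \<beta>0)) (psi_tilde A4 lam X (supp X \<beta>0)) \<and>
        (supp X \<beta>0 \<noteq> {} \<longrightarrow> design_assumption b d K A4 lam M X \<beta>0)}"

definition rate :: "real \<Rightarrow> nat \<Rightarrow> nat \<Rightarrow> nat \<Rightarrow> nat \<Rightarrow> real" where
  "rate d n p m s =
     real s * max (ln (real p) powr max (d - 1) 1) (ln (1 + real m / real n))"

end

theory Submission
  imports Defs
begin

text \<open>
  The rate is bounded away from zero, because \<open>p \<ge> 2\<close> and \<open>s \<ge> 1\<close>, while total variation never
  exceeds 1; this is the first assertion (\<open>tv_risk_le_1\<close>, \<open>rate_lower_bound\<close>).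

  For the divergence, write the predictive density at \<open>y\<close> as a quotient: the prior integral of
  likelihood times \<open>\<pi>(y | \<beta>)\<close>, divided by the evidence, the prior integral of the likelihood.  It
  suffices to show that, on an event of probability tending to one,
  \<open>g y \<ge> f y * exp (- L - |y - Xt \<beta>0|^2 / (2 m))\<close> for the true density \<open>f\<close> and the predictive density
  \<open>g\<close>, with \<open>L\<close> of the order of the rate.  Then \<open>f ln (f / g)\<close> is at most
  \<open>f * (L + |y - Xt \<beta>0|^2 / (2 m))\<close> pointwise, and Gaussian second moments give a divergence of at
  most \<open>L + 4\<close> (\<open>kl_loss_le\<close>).

  The numerator is bounded below by the contribution of a cube around \<open>\<beta>0\<close> within the model that has
  the true support (\<open>numerator_bound\<close>).  Its half side \<open>1 / (p m)\<close> is so small that neither the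
  likelihood nor the prediction changes by more than the allowed factor.  Up to the Laplace factor
  of \<open>\<beta>0\<close>, its prior mass is at least \<open>exp (- C (s ln p + s ln m))\<close>, and \<open>ln m \<le> ln n + ln (1 + m / n)\<close> makes this the rate
  (\<open>local_mass_ge\<close>).

  The evidence is harder.  The likelihood ratio has expectation one, but the cube carries the
  Laplace factor \<open>exp (- \<lambda> |\<beta>0|_1)\<close>, which can be arbitrarily small, so the evidence has to be bounded by
  a multiple of this same factor.  On the event that all correlations of the noise with the columns are
  below \<open>2 sqrt (n ln p)\<close>, a small fraction \<open>\<alpha>\<close> of the linear term of the log-likelihood ratio can be
  replaced by \<open>\<lambda> / 2\<close> times the distance \<open>|\<beta> - \<beta>0|_1\<close>.  What remains is tilted by \<open>1 - \<alpha>\<close> only, so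
  its expectation decays like \<open>exp (- (\<alpha> - \<alpha>^2 / 2) |X (\<beta> - \<beta>0)|^2)\<close>.  By compatibility this decay
  compensates the loss on the true support and leaves \<open>exp (- \<lambda> / 4 |\<beta> - \<beta>0|_1)\<close>
  (\<open>exponent_bound\<close>).  Against the slabs this integrates to \<open>4 ^ |T|\<close> for each support \<open>T\<close>, which the
  decay of the prior on the model size absorbs (\<open>envelope_expectation\<close>, \<open>prior_decay\<close>).  Markov's
  inequality then bounds the evidence with high probability (\<open>good_event_prob\<close>).
\<close>

section \<open>Gaussian laws on finite products\<close>

lemma lborel_product_sigma_finite: "product_sigma_finite (\<lambda>_::nat. lborel :: real measure)"
  by unfold_locales

lemma sets_lebesgue_prod [simp, measurable_cong]:
  "sets (lebesgue_prod k) = sets (PiM {..<k} (\<lambda>_. borel))"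
  unfolding lebesgue_prod_def by (intro sets_PiM_cong) auto

lemma space_lebesgue_prod [simp]:
  "space (lebesgue_prod k) = space (PiM {..<k} (\<lambda>_. borel))"
  by (intro sets_eq_imp_space_eq) simp

lemma sigma_finite_lebesgue_prod: "sigma_finite_measure (lebesgue_prod k)"
  unfolding lebesgue_prod_def
  by (rule product_sigma_finite.sigma_finite[OF lborel_product_sigma_finite]) simp

lemma gauss_density_pos: "gauss_density k \<mu> y > 0"
  unfolding gauss_density_def by (intro prod_pos) (simp add: normal_density_pos)

lemma gauss_density_measurable [measurable]:
  "(\<lambda>y. gauss_density k \<mu> y) \<in> borel_measurable (PiM {..<k} (\<lambda>_. borel))"
  unfolding gauss_density_def by measurable

lemma normal_density_tilt:
  "normal_density \<mu> 1 x * exp (v * (x - \<mu>)) = exp (v\<^sup>2 / 2) * normal_density (\<mu> + v) 1 x"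
proof -
  have "- ((x - \<mu>)\<^sup>2 / 2) + v * (x - \<mu>) = v\<^sup>2 / 2 - (x - (\<mu> + v))\<^sup>2 / 2"
    by (simp add: power2_eq_square field_simps)
  then show ?thesis
    by (simp add: normal_density_def mult_exp_exp)
qed

lemma nn_integral_normal_density: "(\<integral>\<^sup>+x. ennreal (normal_density \<mu> 1 x) \<partial>lborel) = 1"
proof -
  interpret prob_space "density lborel (normal_density \<mu> 1)"
    by (rule prob_space_normal_density) simp
  show ?thesis
    using emeasure_space_1 by (simp add: emeasure_density)
qed

text \<open>
  Completing the square turns an exponential tilt into a shift of the mean.  All Gaussian
  integrals below (total mass, second moments, tail bounds, expected likelihood ratios) come from
  this formula.
\<close>
lemma nn_integral_gauss_tilt:
  "(\<integral>\<^sup>+y. ennreal (gauss_density k \<mu> y * exp (\<Sum>i<k. v i * (y i - \<mu> i))) \<partial>lebesgue_prod k)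
     = ennreal (exp ((\<Sum>i<k. (v i)\<^sup>2) / 2))"
proof -
  interpret product_sigma_finite "\<lambda>_::nat. lborel :: real measure"
    by (rule lborel_product_sigma_finite)
  have eq: "ennreal (gauss_density k \<mu> y * exp (\<Sum>i<k. v i * (y i - \<mu> i)))
      = (\<Prod>i<k. ennreal (normal_density (\<mu> i) 1 (y i) * exp (v i * (y i - \<mu> i))))" for y
    by (simp add: gauss_density_def exp_sum prod.distrib[symmetric] prod_ennreal)
  have one: "(\<integral>\<^sup>+x. ennreal (normal_density (\<mu> i) 1 x * exp (v i * (x - \<mu> i))) \<partial>lborel)
      = ennreal (exp ((v i)\<^sup>2 / 2))" for i
    by (simp add: normal_density_tilt ennreal_mult nn_integral_cmult nn_integral_normal_density)
  have "(\<integral>\<^sup>+y. ennreal (gauss_density k \<mu> y * exp (\<Sum>i<k. v i * (y i - \<mu> i))) \<partial>lebesgue_prod k)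
      = (\<Prod>i<k. \<integral>\<^sup>+x. ennreal (normal_density (\<mu> i) 1 x * exp (v i * (x - \<mu> i))) \<partial>lborel)"
    unfolding eq lebesgue_prod_def
    by (rule product_nn_integral_prod[where f="\<lambda>i x. ennreal (normal_density (\<mu> i) 1 x * exp (v i * (x - \<mu> i)))"]) simp_all
  also have "\<dots> = ennreal (exp ((\<Sum>i<k. (v i)\<^sup>2) / 2))"
    by (simp add: one prod_ennreal sum_divide_distrib exp_sum)
  finally show ?thesis .
qed

lemma nn_integral_gauss: "(\<integral>\<^sup>+y. ennreal (gauss_density k \<mu> y) \<partial>lebesgue_prod k) = 1"
  using nn_integral_gauss_tilt[of k \<mu> "\<lambda>_. 0"] by simp

lemma prob_space_gauss: "prob_space (gauss_measure k \<mu>)"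
proof
  have "emeasure (gauss_measure k \<mu>) (space (gauss_measure k \<mu>))
      = (\<integral>\<^sup>+y. ennreal (gauss_density k \<mu> y) * indicator (space (lebesgue_prod k)) y \<partial>lebesgue_prod k)"
    unfolding gauss_measure_def by (subst emeasure_density) auto
  also have "\<dots> = (\<integral>\<^sup>+y. ennreal (gauss_density k \<mu> y) \<partial>lebesgue_prod k)"
    by (intro nn_integral_cong) auto
  finally show "emeasure (gauss_measure k \<mu>) (space (gauss_measure k \<mu>)) = 1"
    by (simp add: nn_integral_gauss)
qed

text \<open>
  Only boundedness of the second moment matters later; the crude constant comes from
  \<open>x^2 \<le> 2 exp x + 2 exp (- x)\<close>, which reduces the claim to two tilts.
\<close>
lemma gauss_second_moment_le:
  assumes "j < k"
  shows "(\<integral>\<^sup>+y. ennreal (gauss_density k \<mu> y * (y j - \<mu> j)\<^sup>2) \<partial>lebesgue_prod k) \<le> 8"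
proof -
  define e where "e t i = (if i = j then t else 0 :: real)" for t i
  have lin: "(\<Sum>i<k. e t i * (y i - \<mu> i)) = t * (y j - \<mu> j)" for t y
    using assms by (simp add: e_def if_distrib[of "\<lambda>x. x * _"] cong: if_cong)
  have sq: "(\<Sum>i<k. (e t i)\<^sup>2) = t\<^sup>2" for t
    using assms by (simp add: e_def if_distrib[of "\<lambda>x. x ^ 2"] cong: if_cong)
  have tilt: "(\<integral>\<^sup>+y. ennreal (gauss_density k \<mu> y * exp (t * (y j - \<mu> j))) \<partial>lebesgue_prod k) = ennreal (exp (t\<^sup>2 / 2))" for t
    using nn_integral_gauss_tilt[of k \<mu> "e t"] by (simp add: lin sq)
  have cosh: "x\<^sup>2 \<le> 2 * exp x + 2 * exp (- x)" for x :: real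
  proof -
    have "1 + \<bar>x\<bar> + \<bar>x\<bar>\<^sup>2 / 2 \<le> exp \<bar>x\<bar>"
      by (rule exp_lower_Taylor_quadratic) simp
    then have "x\<^sup>2 \<le> 2 * exp \<bar>x\<bar>" by simp
    also have "exp \<bar>x\<bar> \<le> exp x + exp (- x)"
      by (cases "x \<ge> 0") simp_all
    finally show ?thesis by simp
  qed
  have "(\<integral>\<^sup>+y. ennreal (gauss_density k \<mu> y * (y j - \<mu> j)\<^sup>2) \<partial>lebesgue_prod k)
     \<le> (\<integral>\<^sup>+y. 2 * ennreal (gauss_density k \<mu> y * exp (1 * (y j - \<mu> j))) + 2 * ennreal (gauss_density k \<mu> y * exp ((-1) * (y j - \<mu> j))) \<partial>lebesgue_prod k)"
  proof (intro nn_integral_mono)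
    fix y
    have "gauss_density k \<mu> y * (y j - \<mu> j)\<^sup>2 \<le> gauss_density k \<mu> y * (2 * exp (1 * (y j - \<mu> j)) + 2 * exp ((-1) * (y j - \<mu> j)))"
      using cosh[of "y j - \<mu> j"] gauss_density_pos[of k \<mu> y]
      by (intro mult_left_mono) (auto simp: less_imp_le)
    also have "\<dots> = 2 * (gauss_density k \<mu> y * exp (1 * (y j - \<mu> j))) + 2 * (gauss_density k \<mu> y * exp ((-1) * (y j - \<mu> j)))"
      by (simp add: algebra_simps)
    finally have "ennreal (gauss_density k \<mu> y * (y j - \<mu> j)\<^sup>2) \<le>
      ennreal (2 * (gauss_density k \<mu> y * exp (1 * (y j - \<mu> j))) + 2 * (gauss_density k \<mu> y * exp ((-1) * (y j - \<mu> j))))"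
      by (rule ennreal_leI)
    then show "ennreal (gauss_density k \<mu> y * (y j - \<mu> j)\<^sup>2) \<le> 2 * ennreal (gauss_density k \<mu> y * exp (1 * (y j - \<mu> j))) + 2 * ennreal (gauss_density k \<mu> y * exp ((-1) * (y j - \<mu> j)))"
      using gauss_density_pos[of k \<mu> y]
      by (subst (asm) ennreal_plus) (auto simp: less_imp_le ennreal_mult)
  qed
  also have "\<dots> = 2 * ennreal (exp (1/2)) + 2 * ennreal (exp (1/2))"
  proof -
    have [measurable]: "(\<lambda>y. y j) \<in> borel_measurable (PiM {..<k} (\<lambda>_. borel))"
      using assms by (intro measurable_component_singleton) simp
    show ?thesis
      using tilt[of 1] tilt[of "-1"] by (simp add: nn_integral_add nn_integral_cmult)
  qed
  also have "\<dots> \<le> 8"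
  proof -
    have "exp (1/2) \<le> (2::real)"
      using exp_bound_half[of "1/2::real"] by simp
    then have "ennreal (2 * exp (1/2) + 2 * exp (1/2)) \<le> ennreal 8"
      by (intro ennreal_leI) linarith
    then show ?thesis by (simp add: ennreal_mult distrib_right[symmetric])
  qed
  finally show ?thesis .
qed

text \<open>
  Markov's inequality for the exponential tilt with the optimal slope \<open>t / V\<close>.
\<close>
lemma gauss_chernoff:
  assumes V: "(\<Sum>i<k. (v i)\<^sup>2) = V" "V > 0" and "t > 0"
  shows "emeasure (gauss_measure k \<mu>) {y \<in> space (gauss_measure k \<mu>). t \<le> (\<Sum>i<k. v i * (y i - \<mu> i))}
     \<le> ennreal (exp (- t\<^sup>2 / (2 * V)))"
proof -
  let ?c = "t / V"
  let ?u = "\<lambda>y. ennreal (exp (\<Sum>i<k. (?c * v i) * (y i - \<mu> i)))"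
  let ?M = "gauss_measure k \<mu>"
  have sets: "sets ?M = sets (PiM {..<k} (\<lambda>_. borel))"
    by (simp add: gauss_measure_def)
  have um: "?u \<in> borel_measurable ?M"
    unfolding measurable_cong_sets[OF sets refl] by measurable
  have int: "(\<integral>\<^sup>+y. ?u y \<partial>?M) = ennreal (exp (t\<^sup>2 / (2 * V)))"
  proof -
    have "(\<integral>\<^sup>+y. ?u y \<partial>?M) = (\<integral>\<^sup>+y. ennreal (gauss_density k \<mu> y * exp (\<Sum>i<k. (?c * v i) * (y i - \<mu> i))) \<partial>lebesgue_prod k)"
      unfolding gauss_measure_def
      by (subst nn_integral_density) (auto simp: ennreal_mult less_imp_le[OF gauss_density_pos])
    also have "\<dots> = ennreal (exp ((\<Sum>i<k. (?c * v i)\<^sup>2) / 2))"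
      by (rule nn_integral_gauss_tilt)
    also have "(\<Sum>i<k. (?c * v i)\<^sup>2) = ?c\<^sup>2 * V"
      unfolding V(1)[symmetric] by (simp only: power_mult_distrib sum_distrib_left)
    also have "\<dots> = t\<^sup>2 / V"
      using V by (simp add: power2_eq_square)
    finally show ?thesis by (simp add: mult.commute)
  qed
  have "emeasure ?M {y \<in> space ?M. t \<le> (\<Sum>i<k. v i * (y i - \<mu> i))}
     \<le> emeasure ?M {y \<in> space ?M. 1 \<le> ennreal (exp (- t\<^sup>2 / V)) * ?u y}"
  proof (intro emeasure_mono subsetI)
    fix y assume y: "y \<in> {y \<in> space ?M. t \<le> (\<Sum>i<k. v i * (y i - \<mu> i))}"
    have "?c * t \<le> ?c * (\<Sum>i<k. v i * (y i - \<mu> i))"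
      using y V assms(3) by (intro mult_left_mono) auto
    also have "\<dots> = (\<Sum>i<k. (?c * v i) * (y i - \<mu> i))"
      by (simp only: sum_distrib_left mult.assoc)
    finally have "?c * t \<le> (\<Sum>i<k. (?c * v i) * (y i - \<mu> i))" .
    then have "1 \<le> exp (- t\<^sup>2 / V) * exp (\<Sum>i<k. (?c * v i) * (y i - \<mu> i))"
      by (simp add: mult_exp_exp power2_eq_square)
    then show "y \<in> {y \<in> space ?M. 1 \<le> ennreal (exp (- t\<^sup>2 / V)) * ?u y}"
      using y by (simp add: ennreal_mult[symmetric])
  next
    show "{y \<in> space ?M. 1 \<le> ennreal (exp (- t\<^sup>2 / V)) * ?u y} \<in> sets ?M"
      using um by measurable
  qed
  also have "\<dots> \<le> ennreal (exp (- t\<^sup>2 / V)) * set_nn_integral ?M (space ?M) ?u"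
    using um by (intro nn_integral_Markov_inequality) auto
  also have "set_nn_integral ?M (space ?M) ?u = ennreal (exp (t\<^sup>2 / (2 * V)))"
    using int by (simp cong: nn_integral_cong add: indicator_def)
  also have "ennreal (exp (- t\<^sup>2 / V)) * ennreal (exp (t\<^sup>2 / (2 * V))) = ennreal (exp (- t\<^sup>2 / (2 * V)))"
    using V by (simp add: ennreal_mult[symmetric] mult_exp_exp field_simps)
  finally show ?thesis .
qed

section \<open>The likelihood of the linear model\<close>
lemma mean_vec_eq:
  assumes "i < dim_row X"
  shows "mean_vec X \<beta> i = (\<Sum>j<dim_col X. X $$ (i, j) * \<beta> j)"
  using assms by (simp add: mean_vec_def scalar_prod_def lessThan_atLeast0 index_mult_mat_vec)

lemma mean_vec_diff:
  assumes "i < dim_row X"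
  shows "mean_vec X (\<lambda>j. \<beta> j - \<gamma> j) i = mean_vec X \<beta> i - mean_vec X \<gamma> i"
  using assms by (simp add: mean_vec_eq sum_subtractf right_diff_distrib)

lemma model_density_eq:
  "model_density X \<beta> y = (\<Prod>i<dim_row X. normal_density (\<Sum>j<dim_col X. X $$ (i, j) * \<beta> j) 1 (y i))"
  by (simp add: model_density_def gauss_density_def mean_vec_eq)

lemma model_density_measurable [measurable (raw)]:
  assumes [measurable]: "f \<in> measurable M (PiM {..<dim_col X} (\<lambda>_. borel))"
    and [measurable]: "g \<in> measurable M (PiM {..<dim_row X} (\<lambda>_. borel))"
  shows "(\<lambda>x. model_density X (f x) (g x)) \<in> borel_measurable M"
proof -
  have [measurable]: "(\<lambda>x. f x j) \<in> borel_measurable M" if "j \<in> {..<dim_col X}" for j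
    using that by measurable
  have [measurable]: "(\<lambda>x. g x j) \<in> borel_measurable M" if "j \<in> {..<dim_row X}" for j
    using that by measurable
  show ?thesis
    unfolding model_density_eq normal_density_def by measurable
qed

lemma model_density_pos: "model_density X \<beta> y > 0"
  by (simp add: model_density_def gauss_density_pos)

lemma model_density_le_1: "model_density X \<beta> y \<le> 1"
proof -
  have "normal_density a 1 b \<le> 1" for a b :: real
  proof -
    have "1 \<le> sqrt (2 * pi)" using pi_gt3 by simp
    then show ?thesis
      unfolding normal_density_def by (simp add: divide_le_eq_1 mult_le_one)
         (smt (verit) exp_le_one_iff divide_nonneg_pos zero_le_power2 real_sqrt_ge_1_iff)
  qed
  then show ?thesis
    unfolding model_density_def gauss_density_def by (intro prod_le_1) auto
qed

text \<open>
  The log-likelihood ratio against \<open>\<gamma>\<close> is linear in the noise minus half the squared signal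
  difference; everything about the posterior is derived from this form.
\<close>
lemma model_density_ratio:
  "model_density X \<beta> y = model_density X \<gamma> y *
     exp ((\<Sum>i<dim_row X. mean_vec X (\<lambda>j. \<beta> j - \<gamma> j) i * (y i - mean_vec X \<gamma> i))
        - (\<Sum>i<dim_row X. (mean_vec X (\<lambda>j. \<beta> j - \<gamma> j) i)\<^sup>2) / 2)"
proof -
  have one: "normal_density (a + v) 1 x = normal_density a 1 x * exp (v * (x - a) - v\<^sup>2 / 2)" for a v x :: real
  proof -
    have "normal_density a 1 x * exp (v * (x - a) - v\<^sup>2 / 2) = (normal_density a 1 x * exp (v * (x - a))) / exp (v\<^sup>2 / 2)"
      by (simp add: exp_diff)
    then show ?thesis
      by (simp add: normal_density_tilt)
  qed
  have "normal_density (mean_vec X \<beta> i) 1 (y i) = normal_density (mean_vec X \<gamma> i) 1 (y i) *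
     exp (mean_vec X (\<lambda>j. \<beta> j - \<gamma> j) i * (y i - mean_vec X \<gamma> i) - (mean_vec X (\<lambda>j. \<beta> j - \<gamma> j) i)\<^sup>2 / 2)"
    if "i < dim_row X" for i
    using one[of "mean_vec X \<gamma> i" "mean_vec X (\<lambda>j. \<beta> j - \<gamma> j) i" "y i"] that
    by (simp add: mean_vec_diff)
  then have "model_density X \<beta> y = (\<Prod>i<dim_row X. normal_density (mean_vec X \<gamma> i) 1 (y i) *
     exp (mean_vec X (\<lambda>j. \<beta> j - \<gamma> j) i * (y i - mean_vec X \<gamma> i) - (mean_vec X (\<lambda>j. \<beta> j - \<gamma> j) i)\<^sup>2 / 2))"
    unfolding model_density_def gauss_density_def by (intro prod.cong) auto
  then show ?thesis
    by (simp add: model_density_def gauss_density_def prod.distrib exp_sum[symmetric] sum_subtractf sum_divide_distrib)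
qed

section \<open>Integration against the spike-and-slab prior\<close>

text \<open>
  The prior is given by its measure of sets; this lemma transfers such a mixture identity to integrals.
\<close>
lemma nn_integral_finite_mixture:
  fixes c :: "'i \<Rightarrow> ennreal"
  assumes sets: "\<And>i. i \<in> I \<Longrightarrow> sets (N i) = sets M"
    and em: "\<And>A. A \<in> sets M \<Longrightarrow> emeasure M A = (\<Sum>i\<in>I. c i * emeasure (N i) A)"
    and f: "f \<in> borel_measurable M"
  shows "integral\<^sup>N M f = (\<Sum>i\<in>I. c i * integral\<^sup>N (N i) f)"
  using f
proof (induction rule: borel_measurable_induct)
  case (cong f g)
  have "integral\<^sup>N (N i) f = integral\<^sup>N (N i) g" if "i \<in> I" for i
    using cong(3) sets_eq_imp_space_eq[OF sets[OF that]] by (intro nn_integral_cong) auto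
  moreover have "integral\<^sup>N M f = integral\<^sup>N M g"
    using cong(3) by (intro nn_integral_cong)
  ultimately show ?case using cong(4) by simp
next
  case (set A)
  then show ?case by (simp add: em sets)
next
  case (mult u a)
  have [measurable]: "u \<in> borel_measurable (N i)" if "i \<in> I" for i
    using mult(2) unfolding measurable_cong_sets[OF sets[OF that] refl] .
  show ?case
    using mult by (simp add: nn_integral_cmult sum_distrib_left mult.left_commute)
next
  case (add u v)
  have [measurable]: "u \<in> borel_measurable (N i)" "v \<in> borel_measurable (N i)" if "i \<in> I" for i
    using add.hyps unfolding measurable_cong_sets[OF sets[OF that] refl] by auto
  show ?case
    using add by (simp add: nn_integral_add distrib_left sum.distrib)
next
  case (seq U)
  have m: "U n \<in> borel_measurable (N i)" if "i \<in> I" for i n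
    using seq(1) unfolding measurable_cong_sets[OF sets[OF that] refl] .
  have "integral\<^sup>N M (\<Squnion> range U) = (SUP n. integral\<^sup>N M (U n))"
    using seq by (simp add: nn_integral_monotone_convergence_SUP image_comp SUP_apply[abs_def])
  also have "\<dots> = (SUP n. \<Sum>i\<in>I. c i * integral\<^sup>N (N i) (U n))"
    using seq.IH by simp
  also have "\<dots> = (\<Sum>i\<in>I. SUP n. c i * integral\<^sup>N (N i) (U n))"
  proof (rule ennreal_SUP_sum)
    show "incseq (\<lambda>n. c i * integral\<^sup>N (N i) (U n))" for i
      using \<open>incseq U\<close> by (auto simp: incseq_def le_fun_def intro!: mult_left_mono nn_integral_mono)
  qed
  also have "\<dots> = (\<Sum>i\<in>I. c i * integral\<^sup>N (N i) (\<Squnion> range U))"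
    using \<open>incseq U\<close> m
    by (intro sum.cong refl)
       (simp add: SUP_mult_left_ennreal[symmetric] nn_integral_monotone_convergence_SUP[symmetric] SUP_apply[abs_def] image_comp)
  finally show ?case .
qed

text \<open>
  The map that carries a slab into the full parameter space.  It is phrased with \<open>merge\<close> so that it is
  the second-argument-zero section of the map that defines the mixture components.
\<close>
definition zero_extend :: "nat \<Rightarrow> nat set \<Rightarrow> (nat \<Rightarrow> real) \<Rightarrow> nat \<Rightarrow> real" where
  "zero_extend p T x = merge T ({..<p} - T) (x, \<lambda>_. 0)"

lemma zero_extend_apply:
  "T \<subseteq> {..<p} \<Longrightarrow> i < p \<Longrightarrow> zero_extend p T x i = (if i \<in> T then x i else 0)"
  by (auto simp: zero_extend_def merge_def)

lemma zero_extend_measurable [measurable]: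
  assumes "T \<subseteq> {..<p}"
  shows "zero_extend p T \<in> measurable (PiM T (\<lambda>_. borel)) (PiM {..<p} (\<lambda>_. borel))"
proof (rule measurable_PiM_single')
  fix i assume "i \<in> {..<p}"
  then show "(\<lambda>x. zero_extend p T x i) \<in> borel_measurable (PiM T (\<lambda>_. borel))"
    using assms by (cases "i \<in> T") (simp_all add: zero_extend_apply)
next
  show "zero_extend p T \<in> space (PiM T (\<lambda>_. borel)) \<rightarrow> {..<p} \<rightarrow>\<^sub>E space borel"
    using assms by (auto simp: zero_extend_def merge_def PiE_iff extensional_def space_PiM subset_iff)
qed

definition slab_density :: "real \<Rightarrow> nat set \<Rightarrow> (nat \<Rightarrow> real) \<Rightarrow> real" where
  "slab_density lam T x = (lam / 2) ^ card T * exp (- lam * (\<Sum>i\<in>T. \<bar>x i\<bar>))"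

lemma sets_PiM_lborel [simp]:
  "sets (PiM T (\<lambda>_. lborel :: real measure)) = sets (PiM T (\<lambda>_. borel))"
  by (intro sets_PiM_cong) auto

lemma measurable_PiM_lborel [simp]:
  "measurable (PiM T (\<lambda>_. lborel :: real measure)) N = measurable (PiM T (\<lambda>_. borel)) N"
  by (intro measurable_cong_sets) auto

lemma slab_density_measurable [measurable]:
  "slab_density lam T \<in> borel_measurable (PiM T (\<lambda>_. borel))"
  unfolding slab_density_def by measurable

text \<open>
  The coordinates outside \<open>T\<close> are almost surely zero under the product of point masses, so the inner
  integral only evaluates the integrand at the zero extension.
\<close>
lemma nn_integral_spike_slab_component:
  assumes T: "T \<subseteq> {..<p}" and f[measurable]: "f \<in> borel_measurable (PiM {..<p} (\<lambda>_. borel))"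
  shows "(\<integral>\<^sup>+\<beta>. f \<beta> \<partial>spike_slab_component p lam T)
    = (\<integral>\<^sup>+x. ennreal (slab_density lam T x) * f (zero_extend p T x) \<partial>PiM T (\<lambda>_. lborel))"
proof -
  let ?J = "{..<p} - T"
  let ?R = "PiM ?J (\<lambda>_. return borel (0::real))"
  have setsR: "sets ?R = sets (PiM ?J (\<lambda>_. borel))"
    by (intro sets_PiM_cong) auto
  have sets_slab: "sets (slab lam T) = sets (PiM T (\<lambda>_. borel))"
    by (simp add: slab_def)
  interpret R: prob_space ?R
    by (intro prob_space_PiM prob_space_return) simp
  have un: "T \<union> ?J = {..<p}" using T by auto
  have meas: "merge T ?J \<in> measurable (slab lam T \<Otimes>\<^sub>M ?R) (PiM {..<p} (\<lambda>_. borel))"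
    using measurable_merge[of T ?J "\<lambda>_. borel :: real measure"]
    unfolding measurable_cong_sets[OF sets_pair_measure_cong[OF sets_slab setsR] refl] un .
  have "(\<integral>\<^sup>+\<beta>. f \<beta> \<partial>spike_slab_component p lam T)
      = (\<integral>\<^sup>+z. f (merge T ?J z) \<partial>(slab lam T \<Otimes>\<^sub>M ?R))"
    unfolding spike_slab_component_def using meas by (intro nn_integral_distr) auto
  also have "\<dots> = (\<integral>\<^sup>+x. \<integral>\<^sup>+y. f (merge T ?J (x, y)) \<partial>?R \<partial>slab lam T)"
    using measurable_compose[OF meas f] by (intro R.nn_integral_fst[symmetric]) simp
  also have "\<dots> = (\<integral>\<^sup>+x. f (zero_extend p T x) \<partial>slab lam T)"
  proof (intro nn_integral_cong)
    fix x
    have "AE y in ?R. \<forall>i\<in>?J. y i = 0"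
    proof (intro AE_finite_allI)
      fix i assume "i \<in> ?J"
      then show "AE y in ?R. y i = 0"
        by (intro AE_PiM_component[where P="\<lambda>t. t = (0::real)"]) (auto intro!: prob_space_return simp: AE_return)
    qed simp
    then have "AE y in ?R. f (merge T ?J (x, y)) = f (zero_extend p T x)"
      by eventually_elim (auto simp: zero_extend_def merge_def intro!: arg_cong[where f=f])
    then have "(\<integral>\<^sup>+y. f (merge T ?J (x, y)) \<partial>?R) = (\<integral>\<^sup>+y. f (zero_extend p T x) \<partial>?R)"
      by (rule nn_integral_cong_AE)
    then show "(\<integral>\<^sup>+y. f (merge T ?J (x, y)) \<partial>?R) = f (zero_extend p T x)"
      by (simp add: R.emeasure_space_1)
  qed
  also have "\<dots> = (\<integral>\<^sup>+x. ennreal (slab_density lam T x) * f (zero_extend p T x) \<partial>PiM T (\<lambda>_. lborel))"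
    unfolding slab_def slab_density_def[symmetric] using T
    by (intro nn_integral_density) (auto intro!: measurable_compose[OF zero_extend_measurable f])
  finally show ?thesis .
qed

text \<open>
  Indexing the mixture by supports instead of first by sizes turns the nested sum into a single
  one.
\<close>
definition prior_weight :: "nat \<Rightarrow> (nat \<Rightarrow> real) \<Rightarrow> nat set \<Rightarrow> real" where
  "prior_weight p w T = w (card T) / real (p choose card T)"

lemma nn_integral_spike_slab:
  assumes w: "\<And>k. k \<le> p \<Longrightarrow> 0 \<le> w k" and f[measurable]: "f \<in> borel_measurable (PiM {..<p} (\<lambda>_. borel))"
  shows "(\<integral>\<^sup>+\<beta>. f \<beta> \<partial>spike_slab p lam w) = (\<Sum>T\<in>Pow {..<p}. ennreal (prior_weight p w T) *
     (\<integral>\<^sup>+x. ennreal (slab_density lam T x) * f (zero_extend p T x) \<partial>PiM T (\<lambda>_. lborel)))"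
proof -
  have em: "emeasure (spike_slab p lam w) A
     = (\<Sum>T\<in>Pow {..<p}. ennreal (prior_weight p w T) * emeasure (spike_slab_component p lam T) A)"
    if "A \<in> sets (spike_slab p lam w)" for A
  proof -
    have "(\<Sum>T\<in>Pow {..<p}. ennreal (prior_weight p w T) * emeasure (spike_slab_component p lam T) A)
       = (\<Sum>s\<le>p. \<Sum>T | T \<in> Pow {..<p} \<and> card T = s. ennreal (prior_weight p w T) * emeasure (spike_slab_component p lam T) A)"
      using card_mono[of "{..<p}"] by (intro sum.group[symmetric]) auto
    also have "\<dots> = (\<Sum>s\<le>p. \<Sum>T | T \<subseteq> {..<p} \<and> card T = s. ennreal (w s) * (ennreal (1 / real (p choose s)) * emeasure (spike_slab_component p lam T) A))"
      using w by (intro sum.cong) (auto simp: prior_weight_def mult.assoc[symmetric] ennreal_mult[symmetric])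
    finally show ?thesis
      using that by (simp add: emeasure_spike_slab sum_distrib_left)
  qed
  have "integral\<^sup>N (spike_slab p lam w) f
    = (\<Sum>T\<in>Pow {..<p}. ennreal (prior_weight p w T) * integral\<^sup>N (spike_slab_component p lam T) f)"
    using em by (intro nn_integral_finite_mixture) (auto simp: measurable_cong_sets[OF sets_spike_slab refl])
  also have "\<dots> = (\<Sum>T\<in>Pow {..<p}. ennreal (prior_weight p w T) *
     (\<integral>\<^sup>+x. ennreal (slab_density lam T x) * f (zero_extend p T x) \<partial>PiM T (\<lambda>_. lborel)))"
    by (intro sum.cong refl arg_cong2[where f="(*)"] nn_integral_spike_slab_component) auto
  finally show ?thesis .
qed

text \<open>
  A function of the model size is averaged by the size distribution alone, since each size class
  shares its weight evenly among its \<open>p choose s\<close> supports.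
\<close>
lemma sum_prior_weight:
  assumes w: "\<And>k. k \<le> p \<Longrightarrow> 0 \<le> w k" and g: "\<And>k. 0 \<le> g k"
  shows "(\<Sum>T\<in>Pow {..<p}. ennreal (prior_weight p w T) * ennreal (g (card T))) = ennreal (\<Sum>s\<le>p. w s * g s)"
proof -
  have nn: "0 \<le> prior_weight p w T * g (card T)" if "T \<in> Pow {..<p}" for T
  proof -
    have "card T \<le> p" using that card_mono[of "{..<p}" T] by auto
    then show ?thesis using w g by (simp add: prior_weight_def)
  qed
  have "(\<Sum>T\<in>Pow {..<p}. prior_weight p w T * g (card T))
       = (\<Sum>s\<le>p. \<Sum>T | T \<in> Pow {..<p} \<and> card T = s. prior_weight p w T * g (card T))"
    using card_mono[of "{..<p}"] by (intro sum.group[symmetric]) auto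
  also have "\<dots> = (\<Sum>s\<le>p. w s * g s)"
  proof (intro sum.cong refl)
    fix s assume "s \<in> {..p}"
    then have c: "p choose s > 0" by (simp add: zero_less_binomial)
    have "(\<Sum>T | T \<in> Pow {..<p} \<and> card T = s. prior_weight p w T * g (card T))
       = (\<Sum>T | T \<in> Pow {..<p} \<and> card T = s. w s / real (p choose s) * g s)"
      by (intro sum.cong) (auto simp: prior_weight_def)
    also have "\<dots> = w s * g s"
      using c n_subsets[of "{..<p}" s] by simp
    finally show "(\<Sum>T | T \<in> Pow {..<p} \<and> card T = s. prior_weight p w T * g (card T)) = w s * g s" .
  qed
  finally have "ennreal (\<Sum>T\<in>Pow {..<p}. prior_weight p w T * g (card T)) = ennreal (\<Sum>s\<le>p. w s * g s)"
    by simp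
  moreover have "(\<Sum>T\<in>Pow {..<p}. ennreal (prior_weight p w T) * ennreal (g (card T)))
      = (\<Sum>T\<in>Pow {..<p}. ennreal (prior_weight p w T * g (card T)))"
    by (intro sum.cong refl) (simp add: ennreal_mult'' g)
  moreover have "\<dots> = ennreal (\<Sum>T\<in>Pow {..<p}. prior_weight p w T * g (card T))"
    by (rule sum_ennreal) (rule nn)
  ultimately show ?thesis by simp
qed

lemma nn_integral_laplace:
  assumes "c > 0"
  shows "(\<integral>\<^sup>+x. ennreal (exp (- c * \<bar>x - a\<bar>)) \<partial>lborel) = ennreal (2 / c)"
proof -
  have half: "(\<integral>\<^sup>+x. ennreal (exp (- c * x)) * indicator {0..} x \<partial>lborel) = ennreal (1 / c)"
  proof -
    have "(\<integral>\<^sup>+x. ennreal (exp (- c * x)) * indicator {0..} x \<partial>lborel)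
        = ennreal (0 - (- exp (- c * 0) / c))"
    proof (rule nn_integral_FTC_atLeast[where F="\<lambda>x. - exp (- c * x) / c"])
      show "DERIV (\<lambda>x. - exp (- c * x) / c) x :> exp (- c * x)" for x
        using assms by (auto intro!: derivative_eq_intros)
      show "((\<lambda>x. - exp (- c * x) / c) \<longlongrightarrow> 0) at_top"
      proof -
        have "filterlim (\<lambda>x. - c * x) at_bot at_top"
          using assms by (intro filterlim_tendsto_neg_mult_at_bot[OF tendsto_const _ filterlim_ident]) auto
        then have "((\<lambda>x. exp (- c * x)) \<longlongrightarrow> 0) at_top"
          by (rule filterlim_compose[OF exp_at_bot])
        then have "((\<lambda>x. - exp (- c * x) / c) \<longlongrightarrow> - 0 / c) at_top"
          using assms by (intro tendsto_intros) auto
        then show ?thesis by simp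
      qed
    qed auto
    then show ?thesis by simp
  qed
  have "(\<integral>\<^sup>+x. ennreal (exp (- c * \<bar>x - a\<bar>)) \<partial>lborel) = (\<integral>\<^sup>+x. ennreal (exp (- c * \<bar>x\<bar>)) \<partial>lborel)"
    by (subst nn_integral_real_affine[where c=1 and t=a]) auto
  also have "\<dots> = (\<integral>\<^sup>+x. ennreal (exp (- c * x)) * indicator {0..} x + ennreal (exp (c * x)) * indicator {..<0} x \<partial>lborel)"
    by (intro nn_integral_cong) (auto simp: indicator_def)
  also have "\<dots> = (\<integral>\<^sup>+x. ennreal (exp (- c * x)) * indicator {0..} x \<partial>lborel) + (\<integral>\<^sup>+x. ennreal (exp (c * x)) * indicator {..<0} x \<partial>lborel)"
    by (intro nn_integral_add) auto
  also have "(\<integral>\<^sup>+x. ennreal (exp (c * x)) * indicator {..<0} x \<partial>lborel) = (\<integral>\<^sup>+x. ennreal (exp (- c * x)) * indicator {0<..} x \<partial>lborel)"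
    by (subst nn_integral_real_affine[where c="-1" and t=0]) (auto intro!: nn_integral_cong simp: indicator_def)
  also have "\<dots> = (\<integral>\<^sup>+x. ennreal (exp (- c * x)) * indicator {0..} x \<partial>lborel)"
  proof (intro nn_integral_cong_AE)
    have "AE x in lborel. x \<noteq> (0::real)" by (rule AE_lborel_singleton)
    then show "AE x in lborel. ennreal (exp (- c * x)) * indicator {0<..} x = ennreal (exp (- c * x)) * indicator {0..} x"
      by eventually_elim (auto simp: indicator_def)
  qed
  finally show ?thesis
    unfolding half using assms by (simp flip: ennreal_plus)
qed

text \<open>
  With \<open>c = \<lambda>\<close> this normalises the slab; with \<open>c = \<lambda> / 4\<close>, centred at the truth, it produces the factor
  \<open>4 ^ |T|\<close> in the bound on the evidence.
\<close>
lemma nn_integral_laplace_PiM: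
  fixes T :: "nat set"
  assumes "c > 0" "finite T"
  shows "(\<integral>\<^sup>+x. ennreal (exp (- c * (\<Sum>i\<in>T. \<bar>x i - a i\<bar>))) \<partial>PiM T (\<lambda>_. lborel)) = ennreal ((2 / c) ^ card T)"
proof -
  interpret product_sigma_finite "\<lambda>_::nat. lborel :: real measure"
    by unfold_locales
  have "(\<integral>\<^sup>+x. ennreal (exp (- c * (\<Sum>i\<in>T. \<bar>x i - a i\<bar>))) \<partial>PiM T (\<lambda>_. lborel))
     = (\<integral>\<^sup>+x. (\<Prod>i\<in>T. ennreal (exp (- c * \<bar>x i - a i\<bar>))) \<partial>PiM T (\<lambda>_. lborel))"
    using assms by (intro nn_integral_cong) (simp add: sum_distrib_left exp_sum prod_ennreal sum_negf[symmetric] del: sum_negf)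
  also have "\<dots> = (\<Prod>i\<in>T. \<integral>\<^sup>+x. ennreal (exp (- c * \<bar>x - a i\<bar>)) \<partial>lborel)"
    using assms by (intro product_nn_integral_prod[where f="\<lambda>i x. ennreal (exp (- c * \<bar>x - a i\<bar>))"]) auto
  also have "\<dots> = ennreal ((2 / c) ^ card T)"
    unfolding nn_integral_laplace[OF assms(1)] using assms by (simp add: ennreal_power)
  finally show ?thesis .
qed

lemma emeasure_spike_slab_space:
  assumes w: "\<And>k. k \<le> p \<Longrightarrow> 0 \<le> w k" "(\<Sum>k\<le>p. w k) = 1" and lam: "lam > 0"
  shows "emeasure (spike_slab p lam w) (space (spike_slab p lam w)) = 1"
proof -
  have one: "(\<integral>\<^sup>+x. ennreal (slab_density lam T x) \<partial>PiM T (\<lambda>_. lborel)) = 1" if "T \<in> Pow {..<p}" for T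
  proof -
    have fin: "finite T" using that finite_subset by auto
    have "(\<integral>\<^sup>+x. ennreal (slab_density lam T x) \<partial>PiM T (\<lambda>_. lborel))
      = (\<integral>\<^sup>+x. ennreal ((lam / 2) ^ card T) * ennreal (exp (- lam * (\<Sum>i\<in>T. \<bar>x i - 0\<bar>))) \<partial>PiM T (\<lambda>_. lborel))"
      using lam by (simp add: slab_density_def ennreal_mult)
    also have "\<dots> = ennreal ((lam / 2) ^ card T) * ennreal ((2 / lam) ^ card T)"
      using nn_integral_laplace_PiM[OF lam fin, of "\<lambda>_. 0"] by (subst nn_integral_cmult) auto
    also have "\<dots> = 1"
      using lam by (simp add: ennreal_mult[symmetric] power_mult_distrib[symmetric])
    finally show ?thesis .
  qed
  have "emeasure (spike_slab p lam w) (space (spike_slab p lam w)) = (\<integral>\<^sup>+\<beta>. 1 \<partial>spike_slab p lam w)"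
    by simp
  also have "\<dots> = (\<Sum>T\<in>Pow {..<p}. ennreal (prior_weight p w T) * ennreal 1)"
    using w by (subst nn_integral_spike_slab) (auto simp: one intro!: sum.cong)
  also have "\<dots> = 1"
    using sum_prior_weight[where g="\<lambda>_. 1" and p=p and w=w] w by simp
  finally show ?thesis .
qed

section \<open>Geometry of the design\<close>
lemma L2_set_sum_le: "L2_set (\<lambda>i. \<Sum>j\<in>J. f j i) A \<le> (\<Sum>j\<in>J. L2_set (f j) A)"
proof (induction J rule: infinite_finite_induct)
  case (insert j J)
  then show ?case
    using L2_set_triangle_ineq[of "f j" "\<lambda>i. \<Sum>j\<in>J. f j i" A] by simp
qed (simp_all add: L2_set_def)

lemma l2norm_sq: "(l2norm k v)\<^sup>2 = (\<Sum>i<k. (v i)\<^sup>2)"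
  by (simp add: l2norm_def L2_set_def sum_nonneg)

lemma l2norm_nonneg: "0 \<le> l2norm k v"
  by (simp add: l2norm_def)

lemma col_norm_eq:
  assumes "X \<in> carrier_mat n p" "j < p"
  shows "col_norm X j = l2norm n (\<lambda>i. X $$ (i, j))"
  unfolding col_norm_def l2norm_def using assms by (auto intro!: L2_set_cong)

lemma l2norm_mean_vec_le:
  assumes X: "X \<in> carrier_mat n p" and cols: "\<And>j. j < p \<Longrightarrow> col_norm X j = B"
  shows "l2norm n (mean_vec X h) \<le> B * (\<Sum>j<p. \<bar>h j\<bar>)"
proof -
  have "l2norm n (mean_vec X h) = L2_set (\<lambda>i. \<Sum>j<p. h j * X $$ (i, j)) {..<n}"
    unfolding l2norm_def using X by (intro L2_set_cong) (auto simp: mean_vec_eq mult.commute)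
  also have "\<dots> \<le> (\<Sum>j<p. L2_set (\<lambda>i. h j * X $$ (i, j)) {..<n})"
    by (rule L2_set_sum_le)
  also have "\<dots> = (\<Sum>j<p. \<bar>h j\<bar> * B)"
  proof (intro sum.cong refl)
    fix j assume "j \<in> {..<p}"
    then have "col_norm X j = B" and eq: "col_norm X j = l2norm n (\<lambda>i. X $$ (i, j))"
      using cols col_norm_eq[OF X] by auto
    moreover have "L2_set (\<lambda>i. h j * X $$ (i, j)) {..<n} = \<bar>h j\<bar> * L2_set (\<lambda>i. X $$ (i, j)) {..<n}"
      by (simp add: L2_set_def power_mult_distrib sum_distrib_left[symmetric] real_sqrt_mult)
    ultimately show "L2_set (\<lambda>i. h j * X $$ (i, j)) {..<n} = \<bar>h j\<bar> * B"
      by (simp add: l2norm_def)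
  qed
  finally show ?thesis by (simp add: sum_distrib_left mult.commute)
qed

text \<open>
  The compatibility number as an inequality without division, which also covers vectors vanishing on
  \<open>S\<close>.
\<close>
lemma compat_cone:
  assumes compat: "ereal c0 \<le> compat X S" and S: "finite S" and nrm: "mat_norm X > 0"
    and cone: "(\<Sum>i\<in>{..<dim_col X} - S. \<bar>h i\<bar>) \<le> 7 * (\<Sum>i\<in>S. \<bar>h i\<bar>)"
  shows "c0 * mat_norm X * (\<Sum>i\<in>S. \<bar>h i\<bar>) \<le> l2norm (dim_row X) (mean_vec X h) * sqrt (card S)"
proof (cases "\<exists>i\<in>S. h i \<noteq> 0")
  case True
  then have pos: "(\<Sum>i\<in>S. \<bar>h i\<bar>) > 0"
    using S by (auto intro: sum_pos2)
  have "compat X S \<le> ereal (l2norm (dim_row X) (mean_vec X h) * sqrt (card S) / (mat_norm X * (\<Sum>i\<in>S. \<bar>h i\<bar>)))"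
    unfolding compat_def using True cone by (intro INF_lower) auto
  with compat have "c0 \<le> l2norm (dim_row X) (mean_vec X h) * sqrt (card S) / (mat_norm X * (\<Sum>i\<in>S. \<bar>h i\<bar>))"
    using order_trans ereal_less_eq(3) by blast
  then show ?thesis
    using pos nrm by (simp add: pos_le_divide_eq mult.assoc)
next
  case False
  then have "(\<Sum>i\<in>S. \<bar>h i\<bar>) = 0" by simp
  then show ?thesis by (simp only: mult_zero_right) (simp add: l2norm_nonneg)
qed

section \<open>An upper bound on the evidence\<close>

text \<open>
  One regression problem at a fixed sample size.  The requirement \<open>ln p \<ge> 1\<close> holds for all large sample
  sizes and lets \<open>sqrt (ln p)\<close> be bounded by \<open>ln p\<close>.
\<close>
locale sparse_regression =
  fixes X :: "real mat" and n p :: nat and lam :: real and w :: "nat \<Rightarrow> real"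
    and \<beta>0 :: "nat \<Rightarrow> real" and c0 :: real
  assumes X: "X \<in> carrier_mat n p"
    and n: "n \<ge> 1" and p: "p > n" and lnp: "ln (real p) \<ge> 1"
    and cols: "\<And>j. j < p \<Longrightarrow> col_norm X j = sqrt n"
    and lam: "lam = sqrt n / p"
    and w_nonneg: "\<And>k. k \<le> p \<Longrightarrow> 0 \<le> w k" and w_sum: "(\<Sum>k\<le>p. w k) = 1"
    and c0: "c0 > 0" and compat: "ereal c0 \<le> compat X (supp X \<beta>0)"
begin

definition "S = supp X \<beta>0"
definition "noise Y i = Y i - mean_vec X \<beta>0 i"
definition "dev \<beta> j = \<beta> j - \<beta>0 j" for j :: nat
definition "noise_level = 2 * sqrt (n * ln p)"
text \<open>
  The share of the linear term that is given up: it is chosen so that \<open>\<alpha> * noise_level = lam / 2\<close>, half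
  of the decay that the slab provides.
\<close>
definition "\<alpha> = lam / (2 * noise_level)"
text \<open>
  The additive error left by the inequality between arithmetic and geometric mean in
  \<open>exponent_bound\<close>; it equals \<open>2 u^2 / \<alpha>\<close> for \<open>u = lam * sqrt |S| / (c0 * sqrt n)\<close>.
\<close>
definition "\<kappa> = 8 * real (card S) * sqrt (ln p) / (p * c0\<^sup>2)"

lemma dims [simp]: "dim_row X = n" "dim_col X = p"
  using X by auto

lemma S_sub: "S \<subseteq> {..<p}" and S_fin: "finite S" and S_card: "card S \<le> p"
proof -
  show "S \<subseteq> {..<p}" by (auto simp: S_def supp_def)
  then show "finite S" "card S \<le> p"
    using finite_subset card_mono[of "{..<p}" S] by auto
qed

lemma lam_pos: "lam > 0" and noise_level_pos: "noise_level > 0" and alpha_pos: "\<alpha> > 0" and alpha_le_1: "\<alpha> \<le> 1"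
proof -
  show l: "lam > 0" and nl: "noise_level > 0"
    using n p lnp by (simp_all add: lam noise_level_def)
  then show "\<alpha> > 0" by (simp add: \<alpha>_def)
  have "lam \<le> sqrt n * 1"
    using n p unfolding lam by (simp add: divide_le_eq)
  also have "\<dots> \<le> sqrt n * sqrt (ln p)"
    using lnp by (intro mult_left_mono) auto
  also have "\<dots> \<le> 2 * noise_level"
    using lnp by (simp add: noise_level_def real_sqrt_mult)
  finally show "\<alpha> \<le> 1" using nl by (simp add: \<alpha>_def)
qed

lemma mat_norm_X: "mat_norm X = sqrt n"
proof -
  have "col_norm X ` {..<dim_col X} = {sqrt n}"
    using cols p by (auto intro!: image_eqI[where x=0])
  then show ?thesis by (simp add: mat_norm_def)
qed

definition "noise_event Y \<longleftrightarrow> (\<forall>j<p. \<bar>\<Sum>i<n. X $$ (i, j) * noise Y i\<bar> \<le> noise_level)"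

lemma noise_inner_le:
  assumes "noise_event Y"
  shows "\<bar>\<Sum>i<n. mean_vec X h i * noise Y i\<bar> \<le> noise_level * (\<Sum>j<p. \<bar>h j\<bar>)"
proof -
  have "(\<Sum>i<n. mean_vec X h i * noise Y i) = (\<Sum>i<n. \<Sum>j<p. h j * (X $$ (i, j) * noise Y i))"
    by (intro sum.cong refl) (simp add: mean_vec_eq sum_distrib_right sum_distrib_left mult_ac)
  also have "\<dots> = (\<Sum>j<p. h j * (\<Sum>i<n. X $$ (i, j) * noise Y i))"
    by (subst sum.swap) (simp add: sum_distrib_left)
  also have "\<bar>\<dots>\<bar> \<le> (\<Sum>j<p. \<bar>h j * (\<Sum>i<n. X $$ (i, j) * noise Y i)\<bar>)"
    by (rule sum_abs)
  also have "\<dots> \<le> (\<Sum>j<p. \<bar>h j\<bar> * noise_level)"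
    using assms by (intro sum_mono) (auto simp: abs_mult noise_event_def intro!: mult_left_mono)
  finally show ?thesis by (simp add: sum_distrib_left mult.commute)
qed

lemma space_model: "space (model X \<beta>) = space (PiM {..<n} (\<lambda>_. borel))"
  by (simp add: model_def gauss_measure_def)

lemma sets_model: "sets (model X \<beta>) = sets (PiM {..<n} (\<lambda>_. borel))"
  by (simp add: model_def gauss_measure_def)

lemma prob_space_model: "prob_space (model X \<beta>)"
  unfolding model_def by (rule prob_space_gauss)

text \<open>
  Each of the \<open>2 p\<close> one-sided events has probability at most \<open>exp (- 2 ln p) = p powr (- 2)\<close>.
\<close>
lemma noise_event_prob:
  "{Y \<in> space (model X \<beta>0). \<not> noise_event Y} \<in> sets (model X \<beta>0)"
  "emeasure (model X \<beta>0) {Y \<in> space (model X \<beta>0). \<not> noise_event Y} \<le> ennreal (2 / p)"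
proof -
  let ?M = "model X \<beta>0"
  define B where "B s j = {Y \<in> space ?M. noise_level \<le> (\<Sum>i<n. (s * X $$ (i, j)) * (Y i - mean_vec X \<beta>0 i))}" for s :: real and j
  have Bm: "B s j \<in> sets ?M" for s j
    unfolding B_def space_model sets_model by measurable
  have "noise_event Y \<longleftrightarrow> (\<forall>j\<in>{..<p}. \<bar>\<Sum>i<n. X $$ (i, j) * (Y i - mean_vec X \<beta>0 i)\<bar> \<le> noise_level)" for Y
    by (auto simp: noise_event_def noise_def)
  then show "{Y \<in> space ?M. \<not> noise_event Y} \<in> sets ?M"
    unfolding space_model sets_model by simp
  have B_prob: "emeasure ?M (B s j) \<le> ennreal (1 / (real p)\<^sup>2)" if j: "j < p" and s: "s\<^sup>2 = 1" for s j
  proof -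
    have "(\<Sum>i<n. (X $$ (i, j))\<^sup>2) = n"
      using cols[OF j] col_norm_eq[OF X j] by (metis l2norm_sq of_nat_0_le_iff real_sqrt_pow2)
    then have V: "(\<Sum>i<n. (s * X $$ (i, j))\<^sup>2) = n"
      by (simp add: power_mult_distrib s)
    have "emeasure ?M (B s j) \<le> ennreal (exp (- noise_level\<^sup>2 / (2 * real n)))"
      unfolding B_def model_def dims using n noise_level_pos by (intro gauss_chernoff V) auto
    also have "- noise_level\<^sup>2 / (2 * real n) = - 2 * ln p"
      using n lnp by (simp add: noise_level_def power_mult_distrib)
    also have "exp (- 2 * ln p) = 1 / (real p)\<^sup>2"
    proof -
      have "exp (- 2 * ln p) = inverse (exp (ln p)) ^ 2"
        by (simp add: exp_minus[symmetric] exp_of_nat_mult[symmetric])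
      then show ?thesis using p by (simp add: power_one_over inverse_eq_divide)
    qed
    finally show ?thesis .
  qed
  have "{Y \<in> space ?M. \<not> noise_event Y} \<subseteq> (\<Union>(s, j)\<in>{1, -1} \<times> {..<p}. B s j)"
  proof
    fix Y assume Y: "Y \<in> {Y \<in> space ?M. \<not> noise_event Y}"
    then obtain j where j: "j < p" "noise_level < \<bar>\<Sum>i<n. X $$ (i, j) * noise Y i\<bar>"
      by (auto simp: noise_event_def not_le)
    then have "Y \<in> B 1 j \<or> Y \<in> B (-1) j"
      using Y by (auto simp: B_def noise_def sum_negf abs_if split: if_splits)
    then show "Y \<in> (\<Union>(s, j)\<in>{1, -1} \<times> {..<p}. B s j)" using j by auto
  qed
  then have "emeasure ?M {Y \<in> space ?M. \<not> noise_event Y} \<le> emeasure ?M (\<Union>(s, j)\<in>{1, -1} \<times> {..<p}. B s j)"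
    using Bm by (intro emeasure_mono) auto
  also have "\<dots> \<le> (\<Sum>(s, j)\<in>{1, -1} \<times> {..<p}. emeasure ?M (B s j))"
    using emeasure_subadditive_finite[of "{1, -1} \<times> {..<p}" "\<lambda>(s, j). B s j" ?M] Bm
    by (auto simp: case_prod_beta)
  also have "\<dots> \<le> (\<Sum>(s :: real, j)\<in>{1, -1} \<times> {..<p}. ennreal (1 / (real p)\<^sup>2))"
    using B_prob by (intro sum_mono) auto
  also have "\<dots> = ennreal (2 / p)"
    using p by (simp add: ennreal_of_nat_eq_real_of_nat ennreal_mult[symmetric] power2_eq_square card_cartesian_product)
  finally show "emeasure ?M {Y \<in> space ?M. \<not> noise_event Y} \<le> ennreal (2 / p)" .
qed

text \<open>
  The log-factor by which the likelihood is inflated: the first summand pays for replacing a share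
  \<open>\<alpha>\<close> of the linear term on the noise event, the second one normalises by the Laplace factor of
  \<open>\<beta>0\<close>.
\<close>
definition "log_tilt \<beta> = lam / 2 * (\<Sum>j<p. \<bar>dev \<beta> j\<bar>) + lam * (\<Sum>j<p. \<bar>\<beta>0 j\<bar>)"

text \<open>
  An upper bound, on the noise event, for the evidence divided by the true likelihood and by the
  Laplace factor of \<open>\<beta>0\<close>.  Unlike that quotient itself it has a bounded expectation over all \<open>Y\<close>.
\<close>
definition "envelope Y = (\<integral>\<^sup>+\<beta>. ennreal (exp ((1 - \<alpha>) * (\<Sum>i<n. mean_vec X (dev \<beta>) i * noise Y i)
    - (\<Sum>i<n. (mean_vec X (dev \<beta>) i)\<^sup>2) / 2 + log_tilt \<beta>)) \<partial>spike_slab p lam w)"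

text \<open>
  The exponent left after averaging over the noise, including the slab.  Writing \<open>a\<close> and \<open>c\<close> for the
  l1-norms of the deviation on and off the support, the tilt and the slab together give at most
  \<open>3/2 \<lambda> a - 1/2 \<lambda> c\<close>.  After reserving \<open>\<lambda> / 4\<close> of the total deviation one has
  \<open>7/4 \<lambda> a - 1/4 \<lambda> c\<close> left, which is negative outside the cone \<open>c \<le> 7 a\<close>.  Inside the cone,
  compatibility bounds \<open>a\<close> by a multiple of the prediction norm, whose square is available with
  coefficient \<open>\<alpha> / 2\<close>.  This is where the constant 7 in the compatibility number comes from.
\<close>
lemma exponent_bound:
  "- (\<alpha> - \<alpha>\<^sup>2 / 2) * (l2norm n (mean_vec X (dev \<beta>)))\<^sup>2 + log_tilt \<beta> - lam * (\<Sum>j<p. \<bar>\<beta> j\<bar>)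
     \<le> \<kappa> - lam / 4 * (\<Sum>j<p. \<bar>dev \<beta> j\<bar>)"
proof -
  define v where "v = l2norm n (mean_vec X (dev \<beta>))"
  define a where "a = (\<Sum>j\<in>S. \<bar>dev \<beta> j\<bar>)"
  define c where "c = (\<Sum>j\<in>{..<p} - S. \<bar>dev \<beta> j\<bar>)"
  have nn: "a \<ge> 0" "c \<ge> 0" "v \<ge> 0" by (auto simp: a_def c_def v_def l2norm_nonneg intro: sum_nonneg)
  have split: "(\<Sum>j<p. f j) = (\<Sum>j\<in>S. f j) + (\<Sum>j\<in>{..<p} - S. f j)" for f :: "nat \<Rightarrow> real"
    using S_sub by (subst sum.subset_diff[of S]) auto
  have dev1: "(\<Sum>j<p. \<bar>dev \<beta> j\<bar>) = a + c"
    unfolding split a_def c_def ..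
  have b0: "\<beta>0 j = 0" if "j \<in> {..<p} - S" for j
    using that by (auto simp: S_def supp_def)
  have "(\<Sum>j\<in>S. \<bar>\<beta>0 j\<bar>) \<le> (\<Sum>j\<in>S. \<bar>\<beta> j\<bar> + \<bar>dev \<beta> j\<bar>)"
    by (intro sum_mono) (auto simp: dev_def)
  moreover have "c = (\<Sum>j\<in>{..<p} - S. \<bar>\<beta> j\<bar>)"
    unfolding c_def by (intro sum.cong) (auto simp: dev_def b0)
  moreover have "(\<Sum>j\<in>{..<p} - S. \<bar>\<beta>0 j\<bar>) = 0" by (simp add: b0)
  ultimately have norms: "(\<Sum>j<p. \<bar>\<beta>0 j\<bar>) - (\<Sum>j<p. \<bar>\<beta> j\<bar>) \<le> a - c"
    unfolding split by (simp add: sum.distrib a_def)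
  have tilt: "log_tilt \<beta> - lam * (\<Sum>j<p. \<bar>\<beta> j\<bar>) \<le> 3 / 2 * lam * a - lam / 2 * c"
  proof -
    have "log_tilt \<beta> - lam * (\<Sum>j<p. \<bar>\<beta> j\<bar>) = lam / 2 * (a + c) + lam * ((\<Sum>j<p. \<bar>\<beta>0 j\<bar>) - (\<Sum>j<p. \<bar>\<beta> j\<bar>))"
      by (simp add: log_tilt_def dev1 right_diff_distrib)
    also have "\<dots> \<le> lam / 2 * (a + c) + lam * (a - c)"
      using mult_left_mono[OF norms, of lam] lam_pos by simp
    also have "\<dots> = 3 / 2 * lam * a - lam / 2 * c"
      by (simp add: field_simps)
    finally show ?thesis .
  qed
  have quad: "\<alpha> / 2 * v\<^sup>2 \<le> (\<alpha> - \<alpha>\<^sup>2 / 2) * v\<^sup>2"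
  proof (rule mult_right_mono)
    have "\<alpha> * \<alpha> \<le> \<alpha> * 1" using alpha_pos alpha_le_1 by (intro mult_left_mono) auto
    then show "\<alpha> / 2 \<le> \<alpha> - \<alpha>\<^sup>2 / 2" by (simp add: power2_eq_square)
  qed simp
  have key: "7 / 4 * lam * a - lam / 4 * c \<le> \<alpha> / 2 * v\<^sup>2 + \<kappa>"
  proof (cases "c \<le> 7 * a")
    case False
    then have "7 / 4 * lam * a - lam / 4 * c \<le> 0"
      using mult_left_mono[of "7 * a" c lam] lam_pos by (simp add: algebra_simps)
    also have "0 \<le> \<alpha> / 2 * v\<^sup>2 + \<kappa>"
      using alpha_pos lnp c0 by (auto simp: \<kappa>_def intro!: add_nonneg_nonneg)
    finally show ?thesis .
  next
    case True
    have cc: "c0 * sqrt n * a \<le> v * sqrt (card S)"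
      using compat_cone[OF compat[folded S_def] S_fin, of "dev \<beta>"] True n
      by (simp add: mat_norm_X v_def a_def c_def)
    define u where "u = lam * sqrt (card S) / (c0 * sqrt n)"
    have "lam * a \<le> u * v"
      using mult_left_mono[OF cc, of lam] lam_pos c0 n
      by (simp add: u_def field_simps)
    have kap: "\<kappa> = 2 * u\<^sup>2 / \<alpha>"
    proof -
      have "2 * u\<^sup>2 / \<alpha> = 4 * noise_level * lam * card S / (c0\<^sup>2 * n)"
        using lam_pos noise_level_pos
        by (simp add: u_def \<alpha>_def power_mult_distrib power_divide power2_eq_square field_simps)
      also have "\<dots> = 8 * real (card S) * (sqrt n * sqrt n) * sqrt (ln p) / (p * c0\<^sup>2 * n)"
      proof -
        have "4 * (2 * (q * l)) * (q / P) * s / (C * N) = 8 * s * (q * q) * l / (P * C * N)" for q l P s C N :: real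
          by (simp add: field_simps)
        then show ?thesis unfolding noise_level_def lam real_sqrt_mult .
      qed
      also have "sqrt n * sqrt n = real n" by simp
      also have "8 * real (card S) * real n * sqrt (ln p) / (p * c0\<^sup>2 * n) = \<kappa>"
        using n by (simp add: \<kappa>_def)
      finally show ?thesis by simp
    qed
    \<comment> \<open>The square is chosen so that its cross term is the loss and its constant term is \<open>\<kappa>\<close>.\<close>
    have "0 \<le> (\<alpha> * v - 2 * u)\<^sup>2 / (2 * \<alpha>)" using alpha_pos by simp
    also have "\<dots> = \<alpha> / 2 * v\<^sup>2 - 2 * u * v + \<kappa>"
      using alpha_pos unfolding kap by (simp add: power2_eq_square field_simps)
    finally have "2 * (u * v) \<le> \<alpha> / 2 * v\<^sup>2 + \<kappa>" by simp
    moreover have "lam / 4 * c \<ge> 0" "0 \<le> lam * a" using lam_pos nn by auto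
    ultimately show ?thesis using \<open>lam * a \<le> u * v\<close> by linarith
  qed
  show ?thesis
  proof -
    have "lam / 4 * (a + c) = lam * a / 4 + lam * c / 4" "7 / 4 * lam * a = 7 / 4 * (lam * a)"
      "3 / 2 * lam * a = 3 / 2 * (lam * a)" "lam / 2 * c = lam * c / 2" "lam / 4 * c = lam * c / 4"
      by (simp_all add: field_simps)
    with tilt quad key show ?thesis
      unfolding dev1 v_def[symmetric] mult_minus_left by linarith
  qed
qed

lemma mean_vec_measurable [measurable (raw)]:
  assumes "f \<in> measurable M (PiM {..<p} (\<lambda>_. borel))" "i \<in> {..<n}"
  shows "(\<lambda>x. mean_vec X (dev (f x)) i) \<in> borel_measurable M"
proof -
  have [measurable]: "(\<lambda>x. f x j) \<in> borel_measurable M" if "j \<in> {..<p}" for j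
    using that assms(1) by measurable
  have "(\<lambda>x. \<Sum>j<p. X $$ (i, j) * dev (f x) j) \<in> borel_measurable M"
    unfolding dev_def by measurable
  then show ?thesis using assms(2) by (simp add: mean_vec_eq)
qed

lemma log_tilt_measurable [measurable]:
  "log_tilt \<in> borel_measurable (PiM {..<p} (\<lambda>_. borel))"
  unfolding log_tilt_def dev_def by measurable

lemma integrand_measurable:
  "(\<lambda>(Y, \<beta>). ennreal (exp ((1 - \<alpha>) * (\<Sum>i<n. mean_vec X (dev \<beta>) i * noise Y i)
    - (\<Sum>i<n. (mean_vec X (dev \<beta>) i)\<^sup>2) / 2 + log_tilt \<beta>)))
   \<in> borel_measurable (PiM {..<n} (\<lambda>_. borel) \<Otimes>\<^sub>M PiM {..<p} (\<lambda>_. borel))"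
  unfolding noise_def by measurable

lemma finite_measure_prior: "finite_measure (spike_slab p lam w)"
  using emeasure_spike_slab_space[OF w_nonneg w_sum lam_pos] by (intro finite_measureI) simp

lemma envelope_measurable: "envelope \<in> borel_measurable (model X \<beta>0)"
proof -
  interpret finite_measure "spike_slab p lam w" by (rule finite_measure_prior)
  have "(\<lambda>(Y, \<beta>). ennreal (exp ((1 - \<alpha>) * (\<Sum>i<n. mean_vec X (dev \<beta>) i * noise Y i)
    - (\<Sum>i<n. (mean_vec X (dev \<beta>) i)\<^sup>2) / 2 + log_tilt \<beta>)))
   \<in> borel_measurable (model X \<beta>0 \<Otimes>\<^sub>M spike_slab p lam w)"
    using integrand_measurable
    by (simp add: measurable_cong_sets[OF sets_pair_measure_cong[OF sets_model sets_spike_slab] refl])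
  then show ?thesis
    unfolding envelope_def[abs_def] by (rule borel_measurable_nn_integral)
qed

lemma model_tilt:
  "(\<integral>\<^sup>+Y. ennreal (exp (t * (\<Sum>i<n. v i * noise Y i))) \<partial>model X \<beta>0) = ennreal (exp (t\<^sup>2 * (\<Sum>i<n. (v i)\<^sup>2) / 2))"
proof -
  have "(\<integral>\<^sup>+Y. ennreal (exp (t * (\<Sum>i<n. v i * noise Y i))) \<partial>model X \<beta>0)
     = (\<integral>\<^sup>+Y. ennreal (gauss_density n (mean_vec X \<beta>0) Y * exp (\<Sum>i<n. (t * v i) * (Y i - mean_vec X \<beta>0 i))) \<partial>lebesgue_prod n)"
    unfolding model_def gauss_measure_def noise_def dims
    by (subst nn_integral_density) (auto simp: ennreal_mult less_imp_le[OF gauss_density_pos] sum_distrib_left mult.assoc)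
  also have "\<dots> = ennreal (exp ((\<Sum>i<n. (t * v i)\<^sup>2) / 2))"
    by (rule nn_integral_gauss_tilt)
  also have "(\<Sum>i<n. (t * v i)\<^sup>2) = t\<^sup>2 * (\<Sum>i<n. (v i)\<^sup>2)"
    by (simp only: power_mult_distrib sum_distrib_left)
  finally show ?thesis .
qed

text \<open>
  After exchanging the integrals, the noise average is explicit and \<open>exponent_bound\<close> applies under each
  slab.  The remaining Laplace integral has a quarter of the original rate and covers \<open>T\<close> only, hence
  the factor \<open>4 ^ |T|\<close>.
\<close>
lemma envelope_expectation:
  "(\<integral>\<^sup>+Y. envelope Y \<partial>model X \<beta>0) \<le> ennreal (exp \<kappa> * (\<Sum>s\<le>p. w s * 4 ^ s))"
proof -
  let ?\<Pi> = "spike_slab p lam w" and ?M = "model X \<beta>0"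
  interpret P: finite_measure ?\<Pi> by (rule finite_measure_prior)
  interpret M: prob_space ?M by (rule prob_space_model)
  interpret pair_sigma_finite ?\<Pi> ?M by unfold_locales
  let ?q = "\<lambda>\<beta>. \<Sum>i<n. (mean_vec X (dev \<beta>) i)\<^sup>2"
  let ?F = "\<lambda>\<beta>. exp (- (\<alpha> - \<alpha>\<^sup>2 / 2) * ?q \<beta> + log_tilt \<beta>)"
  have Fm[measurable]: "?F \<in> borel_measurable (PiM {..<p} (\<lambda>_. borel))"
    by measurable
  have swap: "(\<lambda>(\<beta>, Y). ennreal (exp ((1 - \<alpha>) * (\<Sum>i<n. mean_vec X (dev \<beta>) i * noise Y i)
    - ?q \<beta> / 2 + log_tilt \<beta>))) \<in> borel_measurable (?\<Pi> \<Otimes>\<^sub>M ?M)"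
    unfolding measurable_cong_sets[OF sets_pair_measure_cong[OF sets_spike_slab sets_model] refl] noise_def
    by measurable
  have "(\<integral>\<^sup>+Y. envelope Y \<partial>?M) = (\<integral>\<^sup>+\<beta>. \<integral>\<^sup>+Y. ennreal (exp ((1 - \<alpha>) * (\<Sum>i<n. mean_vec X (dev \<beta>) i * noise Y i)
    - ?q \<beta> / 2 + log_tilt \<beta>)) \<partial>?M \<partial>?\<Pi>)"
    unfolding envelope_def by (rule Fubini'[OF swap])
  also have "\<dots> = (\<integral>\<^sup>+\<beta>. ennreal (?F \<beta>) \<partial>?\<Pi>)"
  proof (intro nn_integral_cong)
    fix \<beta>
    have "(\<integral>\<^sup>+Y. ennreal (exp ((1 - \<alpha>) * (\<Sum>i<n. mean_vec X (dev \<beta>) i * noise Y i) - ?q \<beta> / 2 + log_tilt \<beta>)) \<partial>?M)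
       = (\<integral>\<^sup>+Y. ennreal (exp (log_tilt \<beta> - ?q \<beta> / 2)) * ennreal (exp ((1 - \<alpha>) * (\<Sum>i<n. mean_vec X (dev \<beta>) i * noise Y i))) \<partial>?M)"
      by (intro nn_integral_cong) (simp add: ennreal_mult[symmetric] mult_exp_exp algebra_simps)
    also have "\<dots> = ennreal (exp (log_tilt \<beta> - ?q \<beta> / 2)) * ennreal (exp ((1 - \<alpha>)\<^sup>2 * ?q \<beta> / 2))"
      unfolding model_tilt[symmetric]
      by (intro nn_integral_cmult) (auto simp: measurable_cong_sets[OF sets_model refl] noise_def)
    also have "\<dots> = ennreal (?F \<beta>)"
      by (simp add: ennreal_mult[symmetric] mult_exp_exp power2_eq_square field_simps)
    finally show "(\<integral>\<^sup>+Y. ennreal (exp ((1 - \<alpha>) * (\<Sum>i<n. mean_vec X (dev \<beta>) i * noise Y i) - ?q \<beta> / 2 + log_tilt \<beta>)) \<partial>?M) = ennreal (?F \<beta>)" .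
  qed
  also have "\<dots> = (\<Sum>T\<in>Pow {..<p}. ennreal (prior_weight p w T) *
     (\<integral>\<^sup>+x. ennreal (slab_density lam T x) * ennreal (?F (zero_extend p T x)) \<partial>PiM T (\<lambda>_. lborel)))"
    using w_nonneg by (intro nn_integral_spike_slab) auto
  also have "\<dots> \<le> (\<Sum>T\<in>Pow {..<p}. ennreal (prior_weight p w T) * ennreal (exp \<kappa> * 4 ^ card T))"
  proof (intro sum_mono mult_left_mono)
    fix T assume "T \<in> Pow {..<p}"
    then have T: "T \<subseteq> {..<p}" and fin: "finite T" by (auto intro: finite_subset)
    have "slab_density lam T x * ?F (zero_extend p T x)
       \<le> ((lam / 2) ^ card T * exp \<kappa>) * exp (- (lam / 4) * (\<Sum>i\<in>T. \<bar>x i - \<beta>0 i\<bar>))" for x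
    proof -
      let ?b = "zero_extend p T x"
      have split: "(\<Sum>j<p. f j) = (\<Sum>j\<in>T. f j) + (\<Sum>j\<in>{..<p} - T. f j)" for f :: "nat \<Rightarrow> real"
        using T by (subst sum.subset_diff[of T]) auto
      have n1: "(\<Sum>j<p. \<bar>?b j\<bar>) = (\<Sum>j\<in>T. \<bar>x j\<bar>)"
        unfolding split using T by (auto simp: zero_extend_apply subset_iff intro!: sum.cong)
      have "(\<Sum>i\<in>T. \<bar>x i - \<beta>0 i\<bar>) = (\<Sum>j\<in>T. \<bar>dev ?b j\<bar>)"
        using T by (auto simp: zero_extend_apply dev_def subset_iff intro!: sum.cong)
      also have "\<dots> \<le> (\<Sum>j<p. \<bar>dev ?b j\<bar>)"
        using T by (intro sum_mono2) auto
      finally have n2: "(\<Sum>i\<in>T. \<bar>x i - \<beta>0 i\<bar>) \<le> (\<Sum>j<p. \<bar>dev ?b j\<bar>)" .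
      have "- (\<alpha> - \<alpha>\<^sup>2 / 2) * ?q ?b + log_tilt ?b - lam * (\<Sum>j\<in>T. \<bar>x j\<bar>)
         \<le> \<kappa> - lam / 4 * (\<Sum>i\<in>T. \<bar>x i - \<beta>0 i\<bar>)"
        using exponent_bound[of ?b] mult_left_mono[OF n2, of "lam / 4"] lam_pos
        unfolding n1 l2norm_sq by linarith
      then have "exp (- lam * (\<Sum>i\<in>T. \<bar>x i\<bar>)) * ?F ?b \<le> exp \<kappa> * exp (- (lam / 4) * (\<Sum>i\<in>T. \<bar>x i - \<beta>0 i\<bar>))"
        by (simp add: mult_exp_exp)
      then show ?thesis
        using lam_pos unfolding slab_density_def by (simp add: mult.assoc mult_left_mono)
    qed
    then have "(\<integral>\<^sup>+x. ennreal (slab_density lam T x) * ennreal (?F (zero_extend p T x)) \<partial>PiM T (\<lambda>_. lborel))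
       \<le> (\<integral>\<^sup>+x. ennreal ((lam / 2) ^ card T * exp \<kappa>) * ennreal (exp (- (lam / 4) * (\<Sum>i\<in>T. \<bar>x i - \<beta>0 i\<bar>))) \<partial>PiM T (\<lambda>_. lborel))"
      using lam_pos by (intro nn_integral_mono) (simp add: ennreal_mult'[symmetric] ennreal_mult''[symmetric] ennreal_leI)
    also have "\<dots> = ennreal ((lam / 2) ^ card T * exp \<kappa>) * ennreal ((2 / (lam / 4)) ^ card T)"
    proof -
      have "lam / 4 > 0" using lam_pos by simp
      from nn_integral_laplace_PiM[OF this fin, of \<beta>0] show ?thesis
        by (subst nn_integral_cmult) auto
    qed
    also have "\<dots> = ennreal (exp \<kappa> * 4 ^ card T)"
    proof -
      have "(lam / 2) ^ card T * (2 / (lam / 4)) ^ card T = 4 ^ card T"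
        using lam_pos by (simp add: power_mult_distrib[symmetric])
      then show ?thesis
        using lam_pos by (simp add: ennreal_mult[symmetric] mult_ac)
    qed
    finally show "(\<integral>\<^sup>+x. ennreal (slab_density lam T x) * ennreal (?F (zero_extend p T x)) \<partial>PiM T (\<lambda>_. lborel))
       \<le> ennreal (exp \<kappa> * 4 ^ card T)" .
  qed simp
  also have "\<dots> = ennreal (\<Sum>s\<le>p. w s * (exp \<kappa> * 4 ^ s))"
    using w_nonneg by (intro sum_prior_weight) auto
  also have "(\<Sum>s\<le>p. w s * (exp \<kappa> * 4 ^ s)) = exp \<kappa> * (\<Sum>s\<le>p. w s * 4 ^ s)"
    by (simp add: sum_distrib_left mult_ac)
  finally show ?thesis .
qed

definition "good_event T Y \<longleftrightarrow> noise_event Y \<and> envelope Y < ennreal T"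

text \<open>
  The union of the exceptional noise event and the event where Markov's inequality for the envelope
  fails.
\<close>
lemma good_event_prob:
  assumes T: "T > 0" and E: "(\<Sum>s\<le>p. w s * 4 ^ s) \<le> 2"
  shows "{Y \<in> space (model X \<beta>0). \<not> good_event T Y} \<in> sets (model X \<beta>0)"
    and "emeasure (model X \<beta>0) {Y \<in> space (model X \<beta>0). \<not> good_event T Y} \<le> ennreal (2 / p + 2 * exp \<kappa> / T)"
proof -
  let ?M = "model X \<beta>0"
  let ?A = "{Y \<in> space ?M. \<not> noise_event Y}" and ?B = "{Y \<in> space ?M. 1 \<le> ennreal (1 / T) * envelope Y}"
  have Bm: "?B \<in> sets ?M" using envelope_measurable by measurable
  have "ennreal T \<le> envelope Y \<longleftrightarrow> 1 \<le> ennreal (1 / T) * envelope Y" for Y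
  proof
    assume "ennreal T \<le> envelope Y"
    then have "ennreal (1 / T) * ennreal T \<le> ennreal (1 / T) * envelope Y"
      by (rule mult_left_mono) simp
    then show "1 \<le> ennreal (1 / T) * envelope Y"
      using T by (simp add: ennreal_mult[symmetric])
  next
    assume "1 \<le> ennreal (1 / T) * envelope Y"
    then have "ennreal T * 1 \<le> ennreal T * (ennreal (1 / T) * envelope Y)"
      by (rule mult_left_mono) simp
    then show "ennreal T \<le> envelope Y"
      using T by (simp add: ennreal_mult[symmetric] mult.assoc[symmetric])
  qed
  then have eq: "{Y \<in> space ?M. \<not> good_event T Y} = ?A \<union> ?B"
    by (auto simp: good_event_def not_less)
  show "{Y \<in> space ?M. \<not> good_event T Y} \<in> sets ?M"
    unfolding eq using noise_event_prob(1) Bm by auto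
  have "emeasure ?M ?B \<le> ennreal (1 / T) * set_nn_integral ?M (space ?M) envelope"
    using envelope_measurable by (intro nn_integral_Markov_inequality) auto
  also have "set_nn_integral ?M (space ?M) envelope = (\<integral>\<^sup>+Y. envelope Y \<partial>?M)"
    by (intro nn_integral_cong) auto
  also have "ennreal (1 / T) * \<dots> \<le> ennreal (1 / T) * ennreal (exp \<kappa> * 2)"
    using E by (intro mult_left_mono order_trans[OF envelope_expectation] ennreal_leI) auto
  also have "\<dots> = ennreal (2 * exp \<kappa> / T)"
    using T by (simp add: ennreal_mult[symmetric] mult.commute)
  finally have B: "emeasure ?M ?B \<le> ennreal (2 * exp \<kappa> / T)" .
  have "emeasure ?M (?A \<union> ?B) \<le> emeasure ?M ?A + emeasure ?M ?B"
    using noise_event_prob(1) Bm by (intro emeasure_subadditive) auto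
  also have "\<dots> \<le> ennreal (2 / p) + ennreal (2 * exp \<kappa> / T)"
    using noise_event_prob(2) B by (rule add_mono)
  also have "\<dots> = ennreal (2 / p + 2 * exp \<kappa> / T)"
    using T by (simp flip: ennreal_plus)
  finally show "emeasure ?M {Y \<in> space ?M. \<not> good_event T Y} \<le> ennreal (2 / p + 2 * exp \<kappa> / T)"
    unfolding eq .
qed

text \<open>
  On the noise event, \<open>\<alpha>\<close> times the linear term is at most \<open>\<alpha> * noise_level = lam / 2\<close> times the
  l1-deviation, which is what \<open>log_tilt\<close> contains.
\<close>
lemma evidence_le_envelope:
  assumes "noise_event Y"
  shows "(\<integral>\<^sup>+\<beta>. ennreal (model_density X \<beta> Y) \<partial>spike_slab p lam w)
     \<le> ennreal (model_density X \<beta>0 Y * exp (- lam * (\<Sum>j<p. \<bar>\<beta>0 j\<bar>))) * envelope Y"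
proof -
  have pt: "model_density X \<beta> Y \<le> (model_density X \<beta>0 Y * exp (- lam * (\<Sum>j<p. \<bar>\<beta>0 j\<bar>))) *
     exp ((1 - \<alpha>) * (\<Sum>i<n. mean_vec X (dev \<beta>) i * noise Y i) - (\<Sum>i<n. (mean_vec X (dev \<beta>) i)\<^sup>2) / 2 + log_tilt \<beta>)" for \<beta>
  proof -
    let ?e = "\<Sum>i<n. mean_vec X (dev \<beta>) i * noise Y i"
    have "\<alpha> * ?e \<le> \<alpha> * (noise_level * (\<Sum>j<p. \<bar>dev \<beta> j\<bar>))"
      using noise_inner_le[OF assms, of "dev \<beta>"] alpha_pos by (intro mult_left_mono) auto
    also have "\<dots> = lam / 2 * (\<Sum>j<p. \<bar>dev \<beta> j\<bar>)"
      using noise_level_pos by (simp add: \<alpha>_def)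
    finally have "?e - (\<Sum>i<n. (mean_vec X (dev \<beta>) i)\<^sup>2) / 2 \<le> - lam * (\<Sum>j<p. \<bar>\<beta>0 j\<bar>) +
       ((1 - \<alpha>) * ?e - (\<Sum>i<n. (mean_vec X (dev \<beta>) i)\<^sup>2) / 2 + log_tilt \<beta>)"
      by (simp add: log_tilt_def left_diff_distrib)
    moreover have "model_density X \<beta> Y = model_density X \<beta>0 Y * exp (?e - (\<Sum>i<n. (mean_vec X (dev \<beta>) i)\<^sup>2) / 2)"
      using model_density_ratio[of X \<beta> Y \<beta>0] by (simp add: dev_def[abs_def] noise_def)
    ultimately show ?thesis
      using model_density_pos[of X \<beta>0 Y] by (simp add: mult.assoc mult_exp_exp)
  qed
  have "(\<integral>\<^sup>+\<beta>. ennreal (model_density X \<beta> Y) \<partial>spike_slab p lam w) \<le> (\<integral>\<^sup>+\<beta>. ennreal (model_density X \<beta>0 Y * exp (- lam * (\<Sum>j<p. \<bar>\<beta>0 j\<bar>))) *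
     ennreal (exp ((1 - \<alpha>) * (\<Sum>i<n. mean_vec X (dev \<beta>) i * noise Y i) - (\<Sum>i<n. (mean_vec X (dev \<beta>) i)\<^sup>2) / 2 + log_tilt \<beta>)) \<partial>spike_slab p lam w)"
    using pt model_density_pos[of X \<beta>0 Y] by (intro nn_integral_mono) (simp add: ennreal_mult[symmetric] ennreal_leI less_imp_le)
  also have "\<dots> = ennreal (model_density X \<beta>0 Y * exp (- lam * (\<Sum>j<p. \<bar>\<beta>0 j\<bar>))) * envelope Y"
    unfolding envelope_def by (intro nn_integral_cmult) (simp add: measurable_cong_sets[OF sets_spike_slab refl])
  finally show ?thesis .
qed

end

section \<open>Posterior predictive densities and their losses\<close>

text \<open>
  A bound, rather than an identity, because it holds for every prior and every \<open>Y\<close>: if the evidence is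
  0 or infinite, then \<open>D / D\<close> is 0 in the extended non-negative reals.
\<close>
lemma posterior_mass_le_1:
  assumes p: "dim_col X = p" and "sets \<pi> = sets (PiM {..<p} (\<lambda>_. borel))"
    and "Y \<in> space (PiM {..<dim_row X} (\<lambda>_. borel))"
  shows "emeasure (posterior X \<pi> Y) (space (posterior X \<pi> Y)) \<le> 1"
proof -
  let ?D = "\<integral>\<^sup>+\<beta>. ennreal (model_density X \<beta> Y) \<partial>\<pi>"
  have m: "(\<lambda>\<beta>. ennreal (model_density X \<beta> Y)) \<in> borel_measurable \<pi>"
    unfolding measurable_cong_sets[OF assms(2) refl] p[symmetric] using assms(3) by measurable
  have "emeasure (posterior X \<pi> Y) (space (posterior X \<pi> Y)) = (\<integral>\<^sup>+\<beta>. 1 \<partial>posterior X \<pi> Y)"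
    by simp
  also have "\<dots> = (\<integral>\<^sup>+\<beta>. ennreal (model_density X \<beta> Y) / ?D \<partial>\<pi>)"
    unfolding posterior_def using m by (subst nn_integral_density) auto
  also have "\<dots> = ?D / ?D"
    using m by (rule nn_integral_divide)
  also have "\<dots> \<le> 1"
    by (cases "?D = 0 \<or> ?D = \<top>") (auto simp: divide_ennreal_def ennreal_divide_self[unfolded divide_ennreal_def] less_top)
  finally show ?thesis .
qed

lemma sets_posterior [simp]: "sets (posterior X \<pi> Y) = sets \<pi>"
  by (simp add: posterior_def)

text \<open>
  The predictive density is a Bochner integral; since Gaussian densities with unit variance are at
  most 1 and the posterior is finite, it agrees with the non-negative integral, to which Fubini's
  theorem applies.
\<close>
lemma pred_density_nn:
  assumes "dim_col X = p" "dim_col Xt = p" "sets \<pi> = sets (PiM {..<p} (\<lambda>_. borel))"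
    and "Y \<in> space (PiM {..<dim_row X} (\<lambda>_. borel))" "y \<in> space (PiM {..<dim_row Xt} (\<lambda>_. borel))"
  shows "ennreal (pred_density X Xt \<pi> Y y) = (\<integral>\<^sup>+\<beta>. ennreal (model_density Xt \<beta> y) \<partial>posterior X \<pi> Y)"
proof -
  interpret finite_measure "posterior X \<pi> Y"
    using posterior_mass_le_1[OF assms(1,3,4)] by (intro finite_measureI) (auto simp: top_unique)
  have "(\<lambda>\<beta>. model_density Xt \<beta> y) \<in> borel_measurable (posterior X \<pi> Y)"
    unfolding measurable_cong_sets[OF trans[OF sets_posterior assms(3)] refl] assms(2)[symmetric] using assms(5) by measurable
  then have "integrable (posterior X \<pi> Y) (\<lambda>\<beta>. model_density Xt \<beta> y)"
    using model_density_le_1[of Xt _ y] model_density_pos[of Xt _ y]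
    by (intro integrable_const_bound[where B=1]) (auto simp: less_imp_le)
  then show ?thesis
    unfolding pred_density_def using model_density_pos[of Xt _ y]
    by (intro nn_integral_eq_integral[symmetric]) (auto simp: less_imp_le)
qed

lemma pred_density_nonneg: "0 \<le> pred_density X Xt \<pi> Y y"
  unfolding pred_density_def using model_density_pos[of Xt _ y] by (intro Bochner_Integration.integral_nonneg) (auto simp: less_imp_le)

lemma pred_density_mass_le_1:
  assumes d: "dim_col X = p" "dim_col Xt = p" "sets \<pi> = sets (PiM {..<p} (\<lambda>_. borel))"
    and Y: "Y \<in> space (PiM {..<dim_row X} (\<lambda>_. borel))"
  shows "(\<integral>\<^sup>+y. ennreal (pred_density X Xt \<pi> Y y) \<partial>lebesgue_prod (dim_row Xt)) \<le> 1"
    and "(\<lambda>y. ennreal (pred_density X Xt \<pi> Y y)) \<in> borel_measurable (lebesgue_prod (dim_row Xt))"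
proof -
  let ?L = "lebesgue_prod (dim_row Xt)" and ?P = "posterior X \<pi> Y"
  interpret Post: finite_measure ?P
    using posterior_mass_le_1[OF d(1,3) Y] by (intro finite_measureI) (auto simp: top_unique)
  interpret L: sigma_finite_measure ?L by (rule sigma_finite_lebesgue_prod)
  interpret pair_sigma_finite ?P ?L by unfold_locales
  have setsP: "sets ?P = sets (PiM {..<dim_col Xt} (\<lambda>_. borel))" using d by simp
  have m: "(\<lambda>(\<beta>, y). ennreal (model_density Xt \<beta> y)) \<in> borel_measurable (?P \<Otimes>\<^sub>M ?L)"
    unfolding measurable_cong_sets[OF sets_pair_measure_cong[OF setsP sets_lebesgue_prod] refl] by measurable
  have m': "(\<lambda>(y, \<beta>). ennreal (model_density Xt \<beta> y)) \<in> borel_measurable (?L \<Otimes>\<^sub>M ?P)"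
    unfolding measurable_cong_sets[OF sets_pair_measure_cong[OF sets_lebesgue_prod setsP] refl] by measurable
  have eq: "ennreal (pred_density X Xt \<pi> Y y) = (\<integral>\<^sup>+\<beta>. ennreal (model_density Xt \<beta> y) \<partial>?P)" if "y \<in> space ?L" for y
    using that by (intro pred_density_nn[OF d Y]) simp
  have "(\<lambda>y. \<integral>\<^sup>+\<beta>. ennreal (model_density Xt \<beta> y) \<partial>?P) \<in> borel_measurable ?L"
    using m' by (rule Post.borel_measurable_nn_integral)
  then show "(\<lambda>y. ennreal (pred_density X Xt \<pi> Y y)) \<in> borel_measurable ?L"
    by (subst measurable_cong[OF eq])
  have "(\<integral>\<^sup>+y. ennreal (pred_density X Xt \<pi> Y y) \<partial>?L) = (\<integral>\<^sup>+y. \<integral>\<^sup>+\<beta>. ennreal (model_density Xt \<beta> y) \<partial>?P \<partial>?L)"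
    using eq by (rule nn_integral_cong)
  also have "\<dots> = (\<integral>\<^sup>+\<beta>. \<integral>\<^sup>+y. ennreal (model_density Xt \<beta> y) \<partial>?L \<partial>?P)"
    by (rule Fubini'[OF m])
  also have "\<dots> = (\<integral>\<^sup>+\<beta>. 1 \<partial>?P)"
    by (simp add: model_density_def nn_integral_gauss)
  also have "\<dots> \<le> 1"
    using posterior_mass_le_1[OF d(1,3) Y] by simp
  finally show "(\<integral>\<^sup>+y. ennreal (pred_density X Xt \<pi> Y y) \<partial>?L) \<le> 1" .
qed

lemma tv_risk_le_1:
  assumes d: "dim_col X = p" "dim_col Xt = p" "sets \<pi> = sets (PiM {..<p} (\<lambda>_. borel))"
  shows "tv_risk X Xt \<pi> \<beta>0 \<le> 1"
proof -
  let ?L = "lebesgue_prod (dim_row Xt)"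
  interpret prob_space "model X \<beta>0" unfolding model_def by (rule prob_space_gauss)
  have tv: "tv_dist ?L (model_density Xt \<beta>0) (pred_density X Xt \<pi> Y) \<le> 1" if "Y \<in> space (model X \<beta>0)" for Y
  proof -
    have Y: "Y \<in> space (PiM {..<dim_row X} (\<lambda>_. borel))"
      using that by (simp add: model_def gauss_measure_def)
    have "(\<integral>\<^sup>+y. ennreal \<bar>model_density Xt \<beta>0 y - pred_density X Xt \<pi> Y y\<bar> \<partial>?L)
      \<le> (\<integral>\<^sup>+y. ennreal (model_density Xt \<beta>0 y) + ennreal (pred_density X Xt \<pi> Y y) \<partial>?L)"
      using pred_density_nonneg[of X Xt \<pi> Y] model_density_pos[of Xt \<beta>0]
      by (intro nn_integral_mono) (auto simp: less_imp_le abs_le_iff add_increasing simp flip: ennreal_plus intro!: ennreal_leI)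
    also have "\<dots> = (\<integral>\<^sup>+y. ennreal (model_density Xt \<beta>0 y) \<partial>?L) + (\<integral>\<^sup>+y. ennreal (pred_density X Xt \<pi> Y y) \<partial>?L)"
      using pred_density_mass_le_1(2)[OF d Y] by (intro nn_integral_add) (auto simp: model_density_def)
    also have "\<dots> \<le> 1 + 1"
      using pred_density_mass_le_1(1)[OF d Y] by (intro add_mono) (auto simp: model_density_def nn_integral_gauss)
    finally have "tv_dist ?L (model_density Xt \<beta>0) (pred_density X Xt \<pi> Y) \<le> (1 + 1) / 2"
      unfolding tv_dist_def by (rule divide_right_mono_ennreal)
    also have "(1 + 1) / 2 = (1 :: ennreal)" by (simp add: ennreal_divide_self)
    finally show ?thesis .
  qed
  have "tv_risk X Xt \<pi> \<beta>0 \<le> (\<integral>\<^sup>+Y. 1 \<partial>model X \<beta>0)"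
    unfolding tv_risk_def using tv by (rule nn_integral_mono)
  then show ?thesis by (simp add: emeasure_space_1)
qed

text \<open>
  A pointwise majorant of the integrand with finite integral bounds the positive part of the
  divergence; subtracting the negative part, even an infinite one, only decreases the value.
\<close>
lemma kl_div_le:
  assumes pos: "\<And>y. y \<in> space N \<Longrightarrow> f y > 0" "\<And>y. y \<in> space N \<Longrightarrow> g y > 0"
    and le: "\<And>y. y \<in> space N \<Longrightarrow> f y * ln (f y / g y) \<le> U y"
    and U: "(\<integral>\<^sup>+y. ennreal (U y) \<partial>N) \<le> ennreal B" "0 \<le> B"
  shows "kl_div N f g \<le> ereal B"
proof -
  have "e2ennreal (kl_integrand f g y) \<le> ennreal (U y)" if "y \<in> space N" for y
  proof -
    have "kl_integrand f g y = ereal (f y * ln (f y / g y))"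
      using pos[OF that] by (simp add: kl_integrand_def)
    then show ?thesis using le[OF that] by (simp add: ennreal_leI)
  qed
  then have "(\<integral>\<^sup>+y. e2ennreal (kl_integrand f g y) \<partial>N) \<le> ennreal B"
    using U by (intro order_trans[OF nn_integral_mono U(1)])
  then have "enn2ereal (\<integral>\<^sup>+y. e2ennreal (kl_integrand f g y) \<partial>N) \<le> ereal B"
    using U(2) by (simp add: less_eq_ennreal.rep_eq enn2ereal_ennreal)
  then show ?thesis
    unfolding kl_div_def by (intro ereal_diff_le_mono_left) auto
qed

lemma emeasure_box:
  assumes "finite T" "r \<ge> 0"
  shows "emeasure (PiM T (\<lambda>_. lborel)) (PiE T (\<lambda>i::nat. {a i - r..a i + r})) = ennreal ((2 * r) ^ card T)"
proof -
  interpret product_sigma_finite "\<lambda>_::nat. lborel :: real measure" by unfold_locales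
  show ?thesis
    using assms by (subst emeasure_PiM) (auto simp: ennreal_power)
qed

section \<open>A lower bound near the true parameter\<close>
locale sparse_prediction = sparse_regression +
  fixes Xt :: "real mat" and m :: nat
  assumes Xt: "Xt \<in> carrier_mat m p" and m: "m \<ge> 1"
    and cols_t: "\<And>j. j < p \<Longrightarrow> col_norm Xt j = sqrt m"
begin

lemma dims_t [simp]: "dim_row Xt = m" "dim_col Xt = p"
  using Xt by auto

text \<open>
  The half side of the cube.  Its size is dictated by the prediction problem: a deviation with l1-norm
  at most \<open>1 / m\<close> changes the mean of the new data by at most \<open>1 / sqrt m\<close> in norm, and the factor
  \<open>1 / p\<close> accounts for up to \<open>p\<close> active coordinates.
\<close>
definition "r = 1 / (real p * real m)"
definition "beta_nbhd = PiE S (\<lambda>i. {\<beta>0 i - r..\<beta>0 i + r})"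
definition "noise_t y i = y i - mean_vec Xt \<beta>0 i"
text \<open>
  A lower bound for the posterior mass of the cube up to the normalisation by the evidence: the weight
  of the true support, the slab mass of a cube with side \<open>2 r\<close> relative to the Laplace factor
  of \<open>\<beta>0\<close>, and the oscillation of slab, likelihood and predictive density over the cube.
\<close>
definition "local_mass = prior_weight p w S * (lam * r) ^ card S
    * exp (- (2 * card S * sqrt (ln p) + 2 * card S + 1))"

lemma r_pos: "r > 0" using p m by (simp add: r_def)

lemma dev_nbhd:
  assumes "x \<in> beta_nbhd"
  shows "(\<Sum>j<p. \<bar>dev (zero_extend p S x) j\<bar>) \<le> card S * r"
    and "(\<Sum>j\<in>S. \<bar>x j\<bar>) \<le> (\<Sum>j<p. \<bar>\<beta>0 j\<bar>) + card S * r"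
proof -
  have b0: "\<beta>0 j = 0" if "j < p" "j \<notin> S" for j
    using that by (auto simp: S_def supp_def)
  have x: "\<bar>x j - \<beta>0 j\<bar> \<le> r" if "j \<in> S" for j
    using PiE_mem[OF assms[unfolded beta_nbhd_def] that] by auto
  have "(\<Sum>j<p. \<bar>dev (zero_extend p S x) j\<bar>) = (\<Sum>j\<in>S. \<bar>x j - \<beta>0 j\<bar>)"
    using S_sub by (intro sum.mono_neutral_cong_right) (auto simp: dev_def zero_extend_apply b0 subset_iff)
  also have "\<dots> \<le> (\<Sum>j\<in>S. r)"
    using x by (intro sum_mono)
  finally show "(\<Sum>j<p. \<bar>dev (zero_extend p S x) j\<bar>) \<le> card S * r" by simp
  have "(\<Sum>j\<in>S. \<bar>x j\<bar>) \<le> (\<Sum>j\<in>S. \<bar>\<beta>0 j\<bar> + r)"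
  proof (intro sum_mono)
    fix j assume "j \<in> S"
    from x[OF this] show "\<bar>x j\<bar> \<le> \<bar>\<beta>0 j\<bar> + r" by linarith
  qed
  also have "\<dots> = (\<Sum>j\<in>S. \<bar>\<beta>0 j\<bar>) + card S * r" by (simp add: sum.distrib)
  also have "(\<Sum>j\<in>S. \<bar>\<beta>0 j\<bar>) \<le> (\<Sum>j<p. \<bar>\<beta>0 j\<bar>)"
    using S_sub by (intro sum_mono2) auto
  finally show "(\<Sum>j\<in>S. \<bar>x j\<bar>) \<le> (\<Sum>j<p. \<bar>\<beta>0 j\<bar>) + card S * r" by simp
qed

lemma radius_bounds:
  shows "real (card S) * r \<le> 1 / m"
    and "sqrt n * (real (card S) * r) \<le> card S"
    and "(sqrt n * (real (card S) * r))\<^sup>2 \<le> card S"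
    and "lam * (real (card S) * r) \<le> card S"
proof -
  have pm: "real p \<ge> 1" "real m \<ge> 1" "real n \<ge> 1" "real (card S) \<le> real p" "real n \<le> real p" using p m n S_card by auto
  have sp: "sqrt n \<le> p"
  proof -
    have "sqrt n \<le> n" using pm by (intro real_le_lsqrt) (auto simp: self_le_power)
    then show ?thesis using pm by linarith
  qed
  show a: "real (card S) * r \<le> 1 / m"
    using pm by (simp add: r_def field_simps)
  have b: "real (card S) * r \<le> card S / p"
  proof -
    have "real (card S) * r = card S / p * (1 / m)" by (simp add: r_def)
    also have "\<dots> \<le> card S / p * 1" using pm by (intro mult_left_mono) auto
    finally show ?thesis by simp
  qed
  have nn: "real (card S) * r \<ge> 0" using r_pos by simp
  show c: "sqrt n * (real (card S) * r) \<le> card S"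
  proof -
    have "sqrt n * (real (card S) * r) \<le> p * (card S / p)"
      using sp b nn by (intro mult_mono) auto
    then show ?thesis using pm by simp
  qed
  have "1 / real m \<le> 1" using pm by simp
  with a have one: "real (card S) * r \<le> 1" by linarith
  show "(sqrt n * (real (card S) * r))\<^sup>2 \<le> card S"
  proof -
    have "(sqrt n * (real (card S) * r))\<^sup>2 = n * ((real (card S) * r) * (real (card S) * r))"
      by (simp add: power_mult_distrib power2_eq_square)
    also have "\<dots> \<le> p * ((card S / p) * 1)"
      using pm b one nn by (intro mult_mono) auto
    finally show ?thesis using pm by simp
  qed
  have "lam \<le> 1" using sp pm by (simp add: lam divide_le_eq)
  then have "lam * (real (card S) * r) \<le> 1 * (card S / p)"
    using b nn lam_pos by (intro mult_mono) auto
  also have "\<dots> \<le> card S" using pm by (simp add: divide_le_eq mult_le_cancel_left1)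
  finally show "lam * (real (card S) * r) \<le> card S" .
qed

text \<open>
  The linear term is controlled by the noise event, the quadratic term by the triangle
  inequality for the columns.
\<close>
lemma likelihood_nbhd:
  assumes "noise_event Y" "x \<in> beta_nbhd"
  shows "model_density X (zero_extend p S x) Y \<ge> model_density X \<beta>0 Y * exp (- (2 * card S * sqrt (ln p) + card S))"
proof -
  let ?h = "dev (zero_extend p S x)"
  have q: "(\<Sum>j<p. \<bar>?h j\<bar>) \<le> card S * r" by (rule dev_nbhd(1)[OF assms(2)])
  have q0: "0 \<le> (\<Sum>j<p. \<bar>?h j\<bar>)" by (intro sum_nonneg) auto
  have "\<bar>\<Sum>i<n. mean_vec X ?h i * noise Y i\<bar> \<le> noise_level * (card S * r)"
    using noise_inner_le[OF assms(1), of ?h] mult_left_mono[OF q, of noise_level] noise_level_pos by linarith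
  also have "\<dots> = 2 * sqrt (ln p) * (sqrt n * (card S * r))"
    by (simp add: noise_level_def real_sqrt_mult)
  also have "\<dots> \<le> 2 * sqrt (ln p) * card S"
    using radius_bounds(2) lnp by (intro mult_left_mono) auto
  finally have i1: "- (2 * sqrt (ln p) * card S) \<le> (\<Sum>i<n. mean_vec X ?h i * noise Y i)" by linarith
  have "l2norm n (mean_vec X ?h) \<le> sqrt n * (card S * r)"
    using l2norm_mean_vec_le[OF X cols, of ?h] mult_left_mono[OF q, of "sqrt n"] by simp
  then have "(l2norm n (mean_vec X ?h))\<^sup>2 \<le> (sqrt n * (card S * r))\<^sup>2"
    by (intro power_mono l2norm_nonneg)
  also note radius_bounds(3)
  finally have i2: "(\<Sum>i<n. (mean_vec X ?h i)\<^sup>2) \<le> card S" by (simp add: l2norm_sq)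
  have "- (2 * card S * sqrt (ln p) + card S) \<le> (\<Sum>i<n. mean_vec X ?h i * noise Y i) - (\<Sum>i<n. (mean_vec X ?h i)\<^sup>2) / 2"
    using i1 i2 by (simp add: mult_ac)
  moreover have "model_density X (zero_extend p S x) Y = model_density X \<beta>0 Y *
     exp ((\<Sum>i<n. mean_vec X ?h i * noise Y i) - (\<Sum>i<n. (mean_vec X ?h i)\<^sup>2) / 2)"
    using model_density_ratio[of X "zero_extend p S x" Y \<beta>0] by (simp add: dev_def[abs_def] noise_def)
  ultimately show ?thesis
    using model_density_pos[of X \<beta>0 Y] by simp
qed

text \<open>
  The bound has to be uniform in the cube but may depend on the new observation.  Splitting
  \<open>|v e| \<le> e^2 / (2 m) + m v^2 / 2\<close> in each coordinate leaves a term in \<open>y\<close> whose mean is of order one,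
  since the total squared noise is of order \<open>m\<close>.
\<close>
lemma prediction_nbhd:
  assumes "x \<in> beta_nbhd"
  shows "model_density Xt (zero_extend p S x) y \<ge> model_density Xt \<beta>0 y * exp (- ((\<Sum>i<m. (noise_t y i)\<^sup>2) / (2 * m) + 1))"
proof -
  let ?h = "dev (zero_extend p S x)"
  have m1: "real m \<ge> 1" using m by simp
  have "l2norm m (mean_vec Xt ?h) \<le> sqrt m * (\<Sum>j<p. \<bar>?h j\<bar>)"
    by (rule l2norm_mean_vec_le[OF Xt cols_t])
  also have "\<dots> \<le> sqrt m * (1 / m)"
    using dev_nbhd(1)[OF assms] radius_bounds(1) by (intro mult_left_mono) auto
  finally have "(l2norm m (mean_vec Xt ?h))\<^sup>2 \<le> (sqrt m * (1 / m))\<^sup>2"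
    by (intro power_mono l2norm_nonneg)
  also have "(sqrt m * (1 / m))\<^sup>2 = 1 / m"
    using m1 by (simp add: power_mult_distrib power_divide) (simp add: power2_eq_square)
  finally have V: "(\<Sum>i<m. (mean_vec Xt ?h i)\<^sup>2) \<le> 1 / m"
    by (simp only: l2norm_sq)
  have pt: "- ((noise_t y i)\<^sup>2 / (2 * m) + m * (mean_vec Xt ?h i)\<^sup>2 / 2) \<le> mean_vec Xt ?h i * noise_t y i" for i
  proof -
    have "0 \<le> (noise_t y i + m * mean_vec Xt ?h i)\<^sup>2 / (2 * m)" by simp
    also have "\<dots> = (noise_t y i)\<^sup>2 / (2 * m) + m * (mean_vec Xt ?h i)\<^sup>2 / 2 + mean_vec Xt ?h i * noise_t y i"
      using m1 by (simp add: power2_eq_square field_simps)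
    finally show ?thesis by linarith
  qed
  have "- ((\<Sum>i<m. (noise_t y i)\<^sup>2) / (2 * m) + m * (\<Sum>i<m. (mean_vec Xt ?h i)\<^sup>2) / 2)
      = (\<Sum>i<m. - ((noise_t y i)\<^sup>2 / (2 * m) + m * (mean_vec Xt ?h i)\<^sup>2 / 2))"
    by (simp add: sum_negf sum.distrib sum_divide_distrib sum_distrib_left sum_subtractf)
  also have "\<dots> \<le> (\<Sum>i<m. mean_vec Xt ?h i * noise_t y i)"
    using pt by (rule sum_mono)
  finally have i1: "- ((\<Sum>i<m. (noise_t y i)\<^sup>2) / (2 * m) + m * (\<Sum>i<m. (mean_vec Xt ?h i)\<^sup>2) / 2) \<le> (\<Sum>i<m. mean_vec Xt ?h i * noise_t y i)" .
  have "m * (\<Sum>i<m. (mean_vec Xt ?h i)\<^sup>2) \<le> m * (1 / m)"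
    using V by (intro mult_left_mono) auto
  then have i2: "m * (\<Sum>i<m. (mean_vec Xt ?h i)\<^sup>2) \<le> 1" using m1 by simp
  have "1 / real m \<le> 1" using m1 by simp
  then have i3: "(\<Sum>i<m. (mean_vec Xt ?h i)\<^sup>2) \<le> 1" using V by linarith
  have "- ((\<Sum>i<m. (noise_t y i)\<^sup>2) / (2 * m) + 1) \<le> (\<Sum>i<m. mean_vec Xt ?h i * noise_t y i) - (\<Sum>i<m. (mean_vec Xt ?h i)\<^sup>2) / 2"
    using i1 i2 i3 by linarith
  moreover have "model_density Xt (zero_extend p S x) y = model_density Xt \<beta>0 y *
     exp ((\<Sum>i<m. mean_vec Xt ?h i * noise_t y i) - (\<Sum>i<m. (mean_vec Xt ?h i)\<^sup>2) / 2)"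
    using model_density_ratio[of Xt "zero_extend p S x" y \<beta>0] by (simp add: dev_def[abs_def] noise_t_def)
  ultimately show ?thesis
    using model_density_pos[of Xt \<beta>0 y] by simp
qed

lemma prior_weight_nonneg: "prior_weight p w S \<ge> 0"
  using w_nonneg S_card by (simp add: prior_weight_def)

text \<open>
  Only the mixture component with the true support is kept, and of it only the cube, on which all
  factors are bounded below by constants.
\<close>
lemma numerator_bound:
  assumes A: "noise_event Y" and Y: "Y \<in> space (PiM {..<n} (\<lambda>_. borel))" and y: "y \<in> space (PiM {..<m} (\<lambda>_. borel))"
  shows "ennreal (model_density X \<beta>0 Y * exp (- lam * (\<Sum>j<p. \<bar>\<beta>0 j\<bar>)) * local_mass
      * (model_density Xt \<beta>0 y * exp (- ((\<Sum>i<m. (noise_t y i)\<^sup>2) / (2 * m)))))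
    \<le> (\<integral>\<^sup>+\<beta>. ennreal (model_density X \<beta> Y * model_density Xt \<beta> y) \<partial>spike_slab p lam w)"
proof -
  let ?f = "\<lambda>\<beta>. ennreal (model_density X \<beta> Y * model_density Xt \<beta> y)"
  have [measurable]: "(\<lambda>\<beta>. model_density X \<beta> Y) \<in> borel_measurable (PiM {..<p} (\<lambda>_. borel))"
    using model_density_measurable[of "\<lambda>x. x" "PiM {..<p} (\<lambda>_. borel)" X "\<lambda>_. Y"] Y by simp
  have [measurable]: "(\<lambda>\<beta>. model_density Xt \<beta> y) \<in> borel_measurable (PiM {..<p} (\<lambda>_. borel))"
    using model_density_measurable[of "\<lambda>x. x" "PiM {..<p} (\<lambda>_. borel)" Xt "\<lambda>_. y"] y by simp
  define K where "K = (lam / 2) ^ card S * exp (- lam * (\<Sum>j<p. \<bar>\<beta>0 j\<bar>) - card S)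
     * (model_density X \<beta>0 Y * exp (- (2 * card S * sqrt (ln p) + card S)))
     * (model_density Xt \<beta>0 y * exp (- ((\<Sum>i<m. (noise_t y i)\<^sup>2) / (2 * m) + 1)))"
  have K0: "K \<ge> 0"
    using lam_pos model_density_pos[of X \<beta>0 Y] model_density_pos[of Xt \<beta>0 y] by (simp add: K_def)
  have pt: "K \<le> slab_density lam S x * (model_density X (zero_extend p S x) Y * model_density Xt (zero_extend p S x) y)"
    if x: "x \<in> beta_nbhd" for x
  proof -
    have "lam * (\<Sum>j\<in>S. \<bar>x j\<bar>) \<le> lam * ((\<Sum>j<p. \<bar>\<beta>0 j\<bar>) + card S * r)"
      using dev_nbhd(2)[OF x] lam_pos by (intro mult_left_mono) auto
    also have "\<dots> \<le> lam * (\<Sum>j<p. \<bar>\<beta>0 j\<bar>) + card S"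
      using radius_bounds(4) by (simp add: distrib_left)
    finally have "exp (- lam * (\<Sum>j<p. \<bar>\<beta>0 j\<bar>) - card S) \<le> exp (- lam * (\<Sum>j\<in>S. \<bar>x j\<bar>))" by simp
    then have s: "(lam / 2) ^ card S * exp (- lam * (\<Sum>j<p. \<bar>\<beta>0 j\<bar>) - card S) \<le> slab_density lam S x"
      unfolding slab_density_def using lam_pos by (intro mult_left_mono) auto
    show ?thesis
      unfolding K_def mult.assoc[of "slab_density lam S x", symmetric]
      using lam_pos model_density_pos[of X \<beta>0 Y] model_density_pos[of Xt \<beta>0 y] model_density_pos[of X "zero_extend p S x" Y]
      by (intro mult_mono s likelihood_nbhd[OF A x] prediction_nbhd[OF x] mult_nonneg_nonneg)
         (auto simp: less_imp_le slab_density_def)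
  qed
  have boxm: "beta_nbhd \<in> sets (PiM S (\<lambda>_. lborel))"
  proof -
    have "beta_nbhd \<in> sets (PiM S (\<lambda>_. borel))"
      unfolding beta_nbhd_def by (rule sets_PiM_I_finite[OF S_fin]) auto
    then show ?thesis by simp
  qed
  have "ennreal (prior_weight p w S * (K * (2 * r) ^ card S)) = ennreal (prior_weight p w S) * (ennreal K * emeasure (PiM S (\<lambda>_. lborel)) beta_nbhd)"
    using prior_weight_nonneg K0 r_pos S_fin by (simp add: beta_nbhd_def emeasure_box ennreal_mult)
  also have "\<dots> = ennreal (prior_weight p w S) * (\<integral>\<^sup>+x. ennreal K * indicator beta_nbhd x \<partial>PiM S (\<lambda>_. lborel))"
    using boxm by (simp add: nn_integral_cmult_indicator)
  also have "\<dots> \<le> ennreal (prior_weight p w S) * (\<integral>\<^sup>+x. ennreal (slab_density lam S x) * ?f (zero_extend p S x) \<partial>PiM S (\<lambda>_. lborel))"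
  proof (intro mult_left_mono nn_integral_mono)
    fix x
    show "ennreal K * indicator beta_nbhd x \<le> ennreal (slab_density lam S x) * ?f (zero_extend p S x)"
      using pt[of x] lam_pos by (cases "x \<in> beta_nbhd") (auto simp: ennreal_mult'[symmetric] slab_density_def intro!: ennreal_leI)
  qed simp
  also have "\<dots> \<le> (\<Sum>T\<in>Pow {..<p}. ennreal (prior_weight p w T) * (\<integral>\<^sup>+x. ennreal (slab_density lam T x) * ?f (zero_extend p T x) \<partial>PiM T (\<lambda>_. lborel)))"
    using S_sub by (intro member_le_sum) auto
  also have "\<dots> = (\<integral>\<^sup>+\<beta>. ?f \<beta> \<partial>spike_slab p lam w)"
    using w_nonneg by (intro nn_integral_spike_slab[symmetric]) auto
  finally have main: "ennreal (prior_weight p w S * (K * (2 * r) ^ card S)) \<le> (\<integral>\<^sup>+\<beta>. ?f \<beta> \<partial>spike_slab p lam w)" .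
  have pow: "(lam / 2) ^ card S * (2 * r) ^ card S = (lam * r) ^ card S"
    unfolding power_mult_distrib[symmetric] by simp
  have exps: "exp (- lam * (\<Sum>j<p. \<bar>\<beta>0 j\<bar>) - card S) * exp (- (2 * card S * sqrt (ln p) + card S)) * exp (- ((\<Sum>i<m. (noise_t y i)\<^sup>2) / (2 * m) + 1))
     = exp (- lam * (\<Sum>j<p. \<bar>\<beta>0 j\<bar>)) * exp (- (2 * card S * sqrt (ln p) + 2 * card S + 1)) * exp (- ((\<Sum>i<m. (noise_t y i)\<^sup>2) / (2 * m)))"
    unfolding mult_exp_exp by (rule arg_cong[where f=exp]) simp
  have regroup: "q * (a * e1 * (D * e2) * (Dt * e3) * b) = D * f1 * (q * c * f2) * (Dt * f3)"
    if "a * b = c" "e1 * e2 * e3 = f1 * f2 * f3" for q a b c e1 e2 e3 f1 f2 f3 D Dt :: real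
  proof -
    have "q * (a * e1 * (D * e2) * (Dt * e3) * b) = q * (a * b) * D * Dt * (e1 * e2 * e3)"
      by (simp only: mult_ac)
    also have "\<dots> = D * f1 * (q * c * f2) * (Dt * f3)"
      unfolding that by (simp only: mult_ac)
    finally show ?thesis .
  qed
  have "prior_weight p w S * (K * (2 * r) ^ card S) = model_density X \<beta>0 Y * exp (- lam * (\<Sum>j<p. \<bar>\<beta>0 j\<bar>)) * local_mass
      * (model_density Xt \<beta>0 y * exp (- ((\<Sum>i<m. (noise_t y i)\<^sup>2) / (2 * m))))"
    unfolding local_mass_def K_def by (rule regroup[OF pow exps])
  with main show ?thesis by simp
qed

end

section \<open>The divergence on the good event\<close>
lemma ennreal_inverse_le:
  assumes "x \<le> ennreal y" "y > 0"
  shows "ennreal (1 / y) \<le> inverse x"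
proof (cases x rule: ennreal_cases)
  case (real t)
  show ?thesis
  proof (cases "t = 0")
    case False
    then have "0 < t" "t \<le> y" using real assms by auto
    then show ?thesis
      using real by (simp add: inverse_ennreal ennreal_leI inverse_eq_divide frac_le)
  qed (use real in simp)
next
  case top
  then show ?thesis using assms by (simp add: top_unique)
qed

context sparse_prediction begin

abbreviation "prior \<equiv> spike_slab p lam w"

lemma local_mass_nonneg: "local_mass \<ge> 0"
  using prior_weight_nonneg lam_pos r_pos by (simp add: local_mass_def)

text \<open>
  The likelihood of \<open>\<beta>0\<close> and the Laplace factor of \<open>\<beta>0\<close> occur in the lower bound for the numerator
  and in the upper bound for the evidence, and cancel.
\<close>
lemma predictive_lower_bound:
  assumes good: "good_event T Y" and T: "T > 0"
    and Y: "Y \<in> space (PiM {..<n} (\<lambda>_. borel))" and y: "y \<in> space (PiM {..<m} (\<lambda>_. borel))"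
  shows "model_density Xt \<beta>0 y * exp (- ((\<Sum>i<m. (noise_t y i)\<^sup>2) / (2 * m))) * (local_mass / T)
    \<le> pred_density X Xt prior Y y"
proof -
  define D where "D = (\<integral>\<^sup>+\<beta>. ennreal (model_density X \<beta> Y) \<partial>prior)"
  define c where "c = model_density X \<beta>0 Y * exp (- lam * (\<Sum>j<p. \<bar>\<beta>0 j\<bar>))"
  define g where "g = model_density Xt \<beta>0 y * exp (- ((\<Sum>i<m. (noise_t y i)\<^sup>2) / (2 * m)))"
  have c: "c > 0" using model_density_pos[of X \<beta>0 Y] by (simp add: c_def)
  have g: "g > 0" using model_density_pos[of Xt \<beta>0 y] by (simp add: g_def)
  have mX [measurable]: "(\<lambda>\<beta>. model_density X \<beta> Y) \<in> borel_measurable prior"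
    using model_density_measurable[of "\<lambda>x. x" "prior" X "\<lambda>_. Y"] Y by (simp add: measurable_ident_sets)
  have mXt [measurable]: "(\<lambda>\<beta>. model_density Xt \<beta> y) \<in> borel_measurable prior"
    using model_density_measurable[of "\<lambda>x. x" "prior" Xt "\<lambda>_. y"] y by (simp add: measurable_ident_sets)
  have "D \<le> ennreal c * envelope Y"
    using evidence_le_envelope good unfolding D_def c_def good_event_def by blast
  also have "\<dots> \<le> ennreal c * ennreal T"
    using good by (intro mult_left_mono) (auto simp: good_event_def)
  finally have D: "D \<le> ennreal (c * T)" using c T by (simp add: ennreal_mult)
  have "ennreal (pred_density X Xt prior Y y) = (\<integral>\<^sup>+\<beta>. ennreal (model_density Xt \<beta> y) \<partial>posterior X prior Y)"
    using Y y by (intro pred_density_nn) auto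
  also have "\<dots> = (\<integral>\<^sup>+\<beta>. ennreal (model_density X \<beta> Y) / D * ennreal (model_density Xt \<beta> y) \<partial>prior)"
    unfolding posterior_def D_def[symmetric] by (subst nn_integral_density) auto
  also have "\<dots> = (\<integral>\<^sup>+\<beta>. ennreal (model_density X \<beta> Y * model_density Xt \<beta> y) / D \<partial>prior)"
    by (intro nn_integral_cong) (simp add: divide_ennreal_def ennreal_mult less_imp_le[OF model_density_pos] mult_ac)
  also have "\<dots> = (\<integral>\<^sup>+\<beta>. ennreal (model_density X \<beta> Y * model_density Xt \<beta> y) \<partial>prior) / D"
    by (intro nn_integral_divide) auto
  finally have eq: "ennreal (pred_density X Xt prior Y y) = (\<integral>\<^sup>+\<beta>. ennreal (model_density X \<beta> Y * model_density Xt \<beta> y) \<partial>prior) / D" .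
  have "ennreal (g * (local_mass / T)) = ennreal (c * local_mass * g) * ennreal (1 / (c * T))"
    using c g T local_mass_nonneg by (simp add: ennreal_mult[symmetric])
  also have "\<dots> \<le> (\<integral>\<^sup>+\<beta>. ennreal (model_density X \<beta> Y * model_density Xt \<beta> y) \<partial>prior) * inverse D"
    using numerator_bound[OF _ Y y] good c T ennreal_inverse_le[OF D]
    by (intro mult_mono) (auto simp: c_def g_def good_event_def)
  also have "\<dots> = ennreal (pred_density X Xt prior Y y)"
    by (simp add: eq divide_ennreal_def)
  finally show ?thesis
    unfolding g_def by (simp add: pred_density_nonneg)
qed

lemma kl_loss_le:
  assumes good: "good_event T Y" and T: "T > 0"
    and Y: "Y \<in> space (PiM {..<n} (\<lambda>_. borel))"
    and L: "exp (- L) \<le> local_mass / T" "L \<ge> 0"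
  shows "kl_loss X Xt prior \<beta>0 Y \<le> ereal (L + 4)"
  unfolding kl_loss_def
proof (rule kl_div_le)
  let ?Q = "\<lambda>y. (\<Sum>i<m. (noise_t y i)\<^sup>2) / (2 * m)"
  let ?f = "model_density Xt \<beta>0" and ?g = "pred_density X Xt prior Y"
  let ?N = "lebesgue_prod (dim_row Xt)"
  show "?f y > 0" for y by (rule model_density_pos)
  have low: "?f y * exp (- (L + ?Q y)) \<le> ?g y" if "y \<in> space ?N" for y
  proof -
    have "?f y * exp (- (L + ?Q y)) = ?f y * exp (- ?Q y) * exp (- L)"
      by (simp add: mult.assoc mult_exp_exp)
    also have "\<dots> \<le> ?f y * exp (- ?Q y) * (local_mass / T)"
      using L model_density_pos[of Xt \<beta>0 y] by (intro mult_left_mono) auto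
    also have "\<dots> \<le> ?g y"
      using that by (intro predictive_lower_bound[OF good T Y]) simp
    finally show ?thesis .
  qed
  show gpos: "?g y > 0" if "y \<in> space ?N" for y
    using low[OF that] model_density_pos[of Xt \<beta>0 y] by (smt (verit) exp_gt_zero mult_pos_pos)
  show "?f y * ln (?f y / ?g y) \<le> ?f y * (L + ?Q y)" if y: "y \<in> space ?N" for y
  proof -
    have f: "?f y > 0" by (rule model_density_pos)
    have "ln (?f y * exp (- (L + ?Q y))) \<le> ln (?g y)"
      using low[OF y] f gpos[OF y] by (subst ln_le_cancel_iff) auto
    then have "ln (?f y / ?g y) \<le> L + ?Q y"
      using f gpos[OF y] by (simp add: ln_div ln_mult)
    then show ?thesis using f by (intro mult_left_mono) auto
  qed
  show "0 \<le> L + 4" using L by simp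
  have m1: "real m \<ge> 1" using m by simp
  have mt: "(\<lambda>y. noise_t y i) \<in> borel_measurable (PiM {..<m} (\<lambda>_. borel))" if "i < m" for i
  proof -
    have [measurable]: "(\<lambda>y. y i) \<in> borel_measurable (PiM {..<m} (\<lambda>_. borel))"
      using that by (intro measurable_component_singleton) simp
    show ?thesis unfolding noise_t_def by measurable
  qed
  have fm: "?f \<in> borel_measurable (PiM {..<m} (\<lambda>_. borel))"
    unfolding model_density_def by simp
  have "(\<integral>\<^sup>+y. ennreal (?f y * (L + ?Q y)) \<partial>?N)
     = (\<integral>\<^sup>+y. ennreal L * ennreal (?f y) + (\<Sum>i<m. ennreal (1 / (2 * m)) * ennreal (?f y * (noise_t y i)\<^sup>2)) \<partial>?N)"
  proof (intro nn_integral_cong)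
    fix y
    have f: "?f y \<ge> 0" using model_density_pos[of Xt \<beta>0 y] by simp
    have "?f y * (L + ?Q y) = L * ?f y + (\<Sum>i<m. 1 / (2 * m) * (?f y * (noise_t y i)\<^sup>2))"
      by (simp add: distrib_left sum_distrib_left sum_divide_distrib mult_ac)
    then show "ennreal (?f y * (L + ?Q y)) = ennreal L * ennreal (?f y) + (\<Sum>i<m. ennreal (1 / (2 * m)) * ennreal (?f y * (noise_t y i)\<^sup>2))"
      using f L by (simp add: ennreal_mult sum_ennreal sum_nonneg flip: ennreal_mult)
  qed
  also have "\<dots> = ennreal L * (\<integral>\<^sup>+y. ennreal (?f y) \<partial>?N) + (\<Sum>i<m. ennreal (1 / (2 * m)) * (\<integral>\<^sup>+y. ennreal (?f y * (noise_t y i)\<^sup>2) \<partial>?N))"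
  proof -
    have tm: "(\<lambda>y. ennreal (?f y * (noise_t y i)\<^sup>2)) \<in> borel_measurable ?N" if "i < m" for i
      using fm mt[OF that] by simp
    then have "(\<integral>\<^sup>+y. (\<Sum>i<m. ennreal (1 / (2 * m)) * ennreal (?f y * (noise_t y i)\<^sup>2)) \<partial>?N)
       = (\<Sum>i<m. ennreal (1 / (2 * m)) * (\<integral>\<^sup>+y. ennreal (?f y * (noise_t y i)\<^sup>2) \<partial>?N))"
      by (subst nn_integral_sum) (auto simp: nn_integral_cmult)
    moreover have "(\<lambda>y. \<Sum>i<m. ennreal (1 / (2 * m)) * ennreal (?f y * (noise_t y i)\<^sup>2)) \<in> borel_measurable ?N"
      using tm by (intro borel_measurable_sum borel_measurable_times_ennreal) auto
    ultimately show ?thesis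
      using fm by (simp add: nn_integral_add nn_integral_cmult)
  qed
  also have "(\<integral>\<^sup>+y. ennreal (?f y) \<partial>?N) = 1"
    unfolding model_density_def by (rule nn_integral_gauss)
  also have "(\<Sum>i<m. ennreal (1 / (2 * m)) * (\<integral>\<^sup>+y. ennreal (?f y * (noise_t y i)\<^sup>2) \<partial>?N)) \<le> (\<Sum>i<m. ennreal (1 / (2 * m)) * 8)"
    unfolding model_density_def noise_t_def dims_t
    by (intro sum_mono mult_left_mono gauss_second_moment_le) auto
  also have "(\<Sum>i<m. ennreal (1 / (2 * m)) * 8) = ennreal 4"
  proof -
    have "ennreal (1 / (2 * m)) * 8 = ennreal (4 / m)"
      using m1 by (simp add: ennreal_mult'[symmetric] flip: ennreal_numeral)
    then show ?thesis
      using m1 by (simp add: ennreal_of_nat_eq_real_of_nat ennreal_mult[symmetric])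
  qed
  finally show "(\<integral>\<^sup>+y. ennreal (?f y * (L + ?Q y)) \<partial>?N) \<le> ennreal (L + 4)"
    using L by (simp add: ennreal_plus add_left_mono)
qed

text \<open>
  The logarithms of all factors are at most a constant times \<open>s * V\<close>: the prior on the size and the
  choice of the support cost \<open>(A3 + 1) ln p\<close> per active coordinate, the volume of the cube costs
  \<open>2 ln p + ln m\<close>, and the threshold for the evidence costs \<open>\<kappa> + s ln p\<close>.
\<close>
lemma local_mass_ge:
  assumes s: "card S \<le> s" "1 \<le> s"
    and V: "ln p \<le> V" "ln (1 + m / n) \<le> V"
    and A: "A1 > 0" "A3 > 0" and w0: "w 0 \<ge> 1 / 2"
    and wlow: "\<And>k. k \<in> {1..p} \<Longrightarrow> A1 * real p powr (- A3) * w (k - 1) \<le> w k"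
  shows "exp (- ((\<bar>ln A1\<bar> + A3 + 12 + 8 / c0\<^sup>2) * (s * V))) \<le> local_mass / (exp \<kappa> * real p ^ s)"
proof -
  have P: "real p \<ge> 1" "real m \<ge> 1" "real n \<ge> 1" "real n \<le> real p" using p m n by auto
  have V1: "V \<ge> 1" using V lnp by linarith
  have sV: "real (card S) * x \<le> s * V * y" if "x \<le> V * y" "y \<ge> 0" for x y
  proof -
    have "real (card S) * x \<le> real (card S) * (V * y)" using that by (intro mult_left_mono) auto
    also have "\<dots> \<le> s * (V * y)" using s V1 that by (intro mult_right_mono) auto
    finally show ?thesis by (simp add: mult_ac)
  qed
  have sV1: "1 \<le> s * V" using mult_mono[of 1 "real s" 1 V] s V1 by simp
  have wk: "(A1 * real p powr (- A3)) ^ k * (1 / 2) \<le> w k" if "k \<le> p" for k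
    using that
  proof (induction k)
    case (Suc k)
    have "(A1 * real p powr (- A3)) ^ Suc k * (1 / 2) = (A1 * real p powr (- A3)) * ((A1 * real p powr (- A3)) ^ k * (1 / 2))"
      by simp
    also have "\<dots> \<le> (A1 * real p powr (- A3)) * w k"
      using Suc A P by (intro mult_left_mono) auto
    also have "\<dots> \<le> w (Suc k)" using wlow[of "Suc k"] Suc by simp
    finally show ?case .
  qed (use w0 in simp)
  have pwpos: "(A1 * real p powr (- A3)) ^ card S * (1 / 2) / real p ^ card S \<le> prior_weight p w S"
  proof -
    have "p choose card S \<le> p ^ card S" using S_card by (rule binomial_le_pow)
    then have "real (p choose card S) \<le> real p ^ card S" by (metis of_nat_le_iff of_nat_power)
    moreover have "real (p choose card S) > 0" using S_card by (simp add: zero_less_binomial)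
    ultimately show ?thesis
      unfolding prior_weight_def using wk[OF S_card] w_nonneg[OF S_card] A P by (intro frac_le) auto
  qed
  have Wpos: "0 < (A1 * real p powr (- A3)) ^ card S * (1 / 2) / real p ^ card S"
    using A P by simp
  have lnW: "ln ((A1 * real p powr (- A3)) ^ card S * (1 / 2) / real p ^ card S) = card S * (ln A1 - A3 * ln p - ln p) - ln 2"
    using A P by (simp add: ln_div ln_mult ln_realpow ln_powr algebra_simps)
  have pw_eq: "(A1 * real p powr (- A3)) ^ card S * (1 / 2) / real p ^ card S = exp (card S * (ln A1 - A3 * ln p - ln p) - ln 2)"
    unfolding lnW[symmetric] exp_ln[OF Wpos] ..
  have "real (card S) * (- ln A1 + A3 * ln p + ln p) \<le> s * V * (\<bar>ln A1\<bar> + A3 + 1)"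
  proof (rule sV)
    have "- ln A1 \<le> \<bar>ln A1\<bar> * 1" by simp
    also have "\<dots> \<le> \<bar>ln A1\<bar> * V" using V1 by (intro mult_left_mono) auto
    finally have "- ln A1 \<le> \<bar>ln A1\<bar> * V" .
    moreover have "A3 * ln p \<le> A3 * V" using V A by (intro mult_left_mono) auto
    moreover have "V * (\<bar>ln A1\<bar> + A3 + 1) = \<bar>ln A1\<bar> * V + A3 * V + V" by (simp add: algebra_simps)
    ultimately show "- ln A1 + A3 * ln p + ln p \<le> V * (\<bar>ln A1\<bar> + A3 + 1)"
      using V by linarith
  qed (use A in auto)
  moreover have "ln 2 \<le> (1::real)" using ln_le_minus_one[of 2] by simp
  ultimately have e1: "card S * (ln A1 - A3 * ln p - ln p) - ln 2 \<ge> - (s * V * (\<bar>ln A1\<bar> + A3 + 2))"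
    using sV1 by (simp add: algebra_simps)
  have lr: "lam * r > 0" using lam_pos r_pos by simp
  have "ln (lam * r) = ln (sqrt n) - 2 * ln p - ln m"
    using P by (simp add: lam r_def ln_div ln_mult)
  moreover have "ln (sqrt n) \<ge> 0" using P by (intro ln_ge_zero) auto
  moreover have "ln m \<le> 2 * V"
  proof -
    \<comment> \<open>The dimension of the prediction enters the rate only through \<open>m / n\<close>; the missing factor \<open>n\<close> is paid for by \<open>ln p\<close>.\<close>
    have "real m \<le> n * (1 + m / n)" using P by (simp add: field_simps)
    then have "ln m \<le> ln (n * (1 + m / n))" using P by (subst ln_le_cancel_iff) (auto simp: add_pos_nonneg)
    also have "\<dots> = ln n + ln (1 + m / n)" using P by (intro ln_mult_pos) (auto simp: add_pos_nonneg)
    also have "ln n \<le> ln p" using P by simp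
    finally show ?thesis using V by linarith
  qed
  ultimately have "- ln (lam * r) \<le> V * 4" using V by linarith
  from sV[OF this] have e2: "card S * ln (lam * r) \<ge> - (s * V * 4)" by simp
  have lrpow: "(lam * r) ^ card S = exp (card S * ln (lam * r))"
    using lr by (simp add: exp_of_nat_mult)
  have "sqrt (ln p) \<le> ln p" using lnp by (intro real_le_lsqrt) (auto simp: self_le_power)
  then have sq: "sqrt (ln p) \<le> V * 1" using V by linarith
  from sV[OF this] have "2 * card S * sqrt (ln p) \<le> 2 * (s * V)" by simp
  moreover have "2 * real (card S) \<le> 2 * (s * V)" using sV[of 1 1] V1 by simp
  ultimately have e3: "2 * card S * sqrt (ln p) + 2 * card S + 1 \<le> 5 * (s * V)" using sV1 by linarith
  have e4: "\<kappa> \<le> s * V * (8 / c0\<^sup>2)"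
  proof -
    have "\<kappa> = card S * ((sqrt (ln p) / p) * (8 / c0\<^sup>2))" by (simp add: \<kappa>_def)
    also have "\<dots> \<le> s * V * (8 / c0\<^sup>2)"
    proof (rule sV)
      have "sqrt (ln p) / p \<le> sqrt (ln p) / 1" using P lnp by (intro divide_left_mono) auto
      then have "sqrt (ln p) / p \<le> V" using sq by simp
      then show "(sqrt (ln p) / p) * (8 / c0\<^sup>2) \<le> V * (8 / c0\<^sup>2)" by (intro mult_right_mono) auto
    qed simp
    finally show ?thesis .
  qed
  have e5: "s * ln p \<le> s * V" using V by (intro mult_left_mono) auto
  have Tpow: "real p ^ s = exp (s * ln p)" using P by (simp add: exp_of_nat_mult)
  have "- ((\<bar>ln A1\<bar> + A3 + 12 + 8 / c0\<^sup>2) * (s * V))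
     \<le> (card S * (ln A1 - A3 * ln p - ln p) - ln 2) + card S * ln (lam * r) - (2 * card S * sqrt (ln p) + 2 * card S + 1) - \<kappa> - s * ln p"
  proof -
    have "(\<bar>ln A1\<bar> + A3 + 12 + 8 / c0\<^sup>2) * (s * V) = s * V * (\<bar>ln A1\<bar> + A3 + 2) + s * V * 4 + 5 * (s * V) + s * V * (8 / c0\<^sup>2) + s * V"
      by (simp add: algebra_simps)
    then show ?thesis using e1 e2 e3 e4 e5 by linarith
  qed
  then have "exp (- ((\<bar>ln A1\<bar> + A3 + 12 + 8 / c0\<^sup>2) * (s * V)))
     \<le> exp ((card S * (ln A1 - A3 * ln p - ln p) - ln 2) + card S * ln (lam * r) - (2 * card S * sqrt (ln p) + 2 * card S + 1) - \<kappa> - s * ln p)"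
    by simp
  also have "\<dots> = exp (card S * (ln A1 - A3 * ln p - ln p) - ln 2) * (lam * r) ^ card S
      * exp (- (2 * card S * sqrt (ln p) + 2 * card S + 1)) / (exp \<kappa> * real p ^ s)"
    unfolding lrpow Tpow mult_exp_exp exp_diff[symmetric] by (rule arg_cong[where f=exp]) simp
  also have "\<dots> \<le> local_mass / (exp \<kappa> * real p ^ s)"
    unfolding local_mass_def using pwpos[unfolded pw_eq] lr P
    by (intro divide_right_mono mult_right_mono) auto
  finally show ?thesis .
qed

text \<open>
  The threshold \<open>exp \<kappa> * p ^ s\<close> for the envelope is the compromise: its logarithm is within the rate,
  and it exceeds the bound on the expected envelope by a factor \<open>p ^ s / 2\<close>, so that Markov's inequality gives a
  vanishing probability.  The set in question need not be measurable, so it is covered by the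
  complement of the good event.
\<close>
lemma kl_loss_tail:
  assumes s: "card S \<le> s" "1 \<le> s"
    and V: "ln p \<le> V" "ln (1 + m / n) \<le> V"
    and A: "A1 > 0" "A3 > 0" and w0: "w 0 \<ge> 1 / 2"
    and wlow: "\<And>k. k \<in> {1..p} \<Longrightarrow> A1 * real p powr (- A3) * w (k - 1) \<le> w k"
    and E: "(\<Sum>k\<le>p. w k * 4 ^ k) \<le> 2"
  shows "emeasure (model X \<beta>0) {Y \<in> space (model X \<beta>0).
      ereal ((\<bar>ln A1\<bar> + A3 + 17 + 8 / c0\<^sup>2) * (s * V)) \<le> kl_loss X Xt prior \<beta>0 Y} \<le> ennreal (4 / p)"
proof -
  define T where "T = exp \<kappa> * real p ^ s"
  define L where "L = (\<bar>ln A1\<bar> + A3 + 12 + 8 / c0\<^sup>2) * (s * V)"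
  have V1: "V \<ge> 1" using V lnp by linarith
  have p1: "real p \<ge> 1" using p by simp
  have T: "T > 0" using p1 by (simp add: T_def)
  have sV1: "1 \<le> s * V" using mult_mono[of 1 "real s" 1 V] s V1 by simp
  have L0: "L \<ge> 0" unfolding L_def using A sV1 V1 by (intro mult_nonneg_nonneg add_nonneg_nonneg) auto
  have mb: "exp (- L) \<le> local_mass / T"
    unfolding L_def T_def using assms by (intro local_mass_ge) auto
  have less: "L + 4 < (\<bar>ln A1\<bar> + A3 + 17 + 8 / c0\<^sup>2) * (s * V)"
  proof -
    have "(\<bar>ln A1\<bar> + A3 + 17 + 8 / c0\<^sup>2) * (s * V) = L + 5 * (s * V)"
      by (simp add: L_def algebra_simps)
    then show ?thesis using sV1 by linarith
  qed
  have "{Y \<in> space (model X \<beta>0). ereal ((\<bar>ln A1\<bar> + A3 + 17 + 8 / c0\<^sup>2) * (s * V)) \<le> kl_loss X Xt prior \<beta>0 Y}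
     \<subseteq> {Y \<in> space (model X \<beta>0). \<not> good_event T Y}"
  proof safe
    fix Y assume Y: "Y \<in> space (model X \<beta>0)" and le: "ereal ((\<bar>ln A1\<bar> + A3 + 17 + 8 / c0\<^sup>2) * (s * V)) \<le> kl_loss X Xt prior \<beta>0 Y"
      and good: "good_event T Y"
    have "kl_loss X Xt prior \<beta>0 Y \<le> ereal (L + 4)"
      using Y by (intro kl_loss_le[OF good T _ mb L0]) (simp add: space_model)
    with le have "ereal ((\<bar>ln A1\<bar> + A3 + 17 + 8 / c0\<^sup>2) * (s * V)) \<le> ereal (L + 4)" by (rule order_trans)
    with less show False by simp
  qed
  then have "emeasure (model X \<beta>0) {Y \<in> space (model X \<beta>0). ereal ((\<bar>ln A1\<bar> + A3 + 17 + 8 / c0\<^sup>2) * (s * V)) \<le> kl_loss X Xt prior \<beta>0 Y}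
     \<le> emeasure (model X \<beta>0) {Y \<in> space (model X \<beta>0). \<not> good_event T Y}"
    by (rule emeasure_mono) (rule good_event_prob(1)[OF T E])
  also have "\<dots> \<le> ennreal (2 / p + 2 * exp \<kappa> / T)"
    by (rule good_event_prob(2)[OF T E])
  also have "2 / p + 2 * exp \<kappa> / T \<le> 4 / p"
  proof -
    have "real p ^ 1 \<le> real p ^ s" using s p1 by (intro power_increasing) auto
    then have "2 / real p ^ s \<le> 2 / p" using p1 by (intro divide_left_mono) auto
    moreover have "2 * exp \<kappa> / T = 2 / real p ^ s" by (simp add: T_def)
    ultimately show ?thesis by simp
  qed
  then have "ennreal (2 / p + 2 * exp \<kappa> / T) \<le> ennreal (4 / p)" by (rule ennreal_leI)
  finally show ?thesis .
qed

end

section \<open>The theorem\<close>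

text \<open>
  Geometric decay with ratio at most \<open>1 / 8\<close> does two things: the empty model has at least half of the
  mass, so that the lower bounds on the size distribution start from a constant, and the factors
  \<open>4 ^ |T|\<close> from the evidence are summable.
\<close>
lemma prior_decay:
  assumes w: "\<And>k. k \<le> p \<Longrightarrow> 0 \<le> w k" "(\<Sum>k\<le>p. w k) = (1::real)"
    and step: "\<And>k. k \<in> {1..p} \<Longrightarrow> w k \<le> q * w (k - 1)" and q: "0 \<le> q" "q \<le> 1 / 8"
  shows "w 0 \<ge> 1 / 2" and "(\<Sum>k\<le>p. w k * 4 ^ k) \<le> 2"
proof -
  have wk: "w k \<le> (1 / 8) ^ k * w 0" if "k \<le> p" for k
    using that
  proof (induction k)
    case (Suc k)
    have "w (Suc k) \<le> q * w k" using step[of "Suc k"] Suc by simp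
    also have "\<dots> \<le> 1 / 8 * ((1 / 8) ^ k * w 0)"
      using Suc q w(1)[of k] by (intro mult_mono) auto
    finally show ?case by simp
  qed simp
  have geo: "(\<Sum>k\<le>p. (1 / 2 :: real) ^ k) \<le> 2"
  proof -
    have "(\<Sum>k\<le>p. (1 / 2 :: real) ^ k) = 2 - (1 / 2) ^ p"
      by (induction p) auto
    then show ?thesis by simp
  qed
  have w0: "w 0 \<ge> 0" using w(1)[of 0] by simp
  have four: "w k * 4 ^ k \<le> (1 / 2) ^ k * w 0" if "k \<le> p" for k
  proof -
    have "w k * 4 ^ k \<le> ((1 / 8) ^ k * w 0) * 4 ^ k"
      using wk[OF that] by (intro mult_right_mono) auto
    also have "\<dots> = (1 / 8 * 4) ^ k * w 0" by (simp only: power_mult_distrib mult_ac)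
    finally show ?thesis by simp
  qed
  have "(\<Sum>k\<le>p. w k * 4 ^ k) \<le> (\<Sum>k\<le>p. (1 / 2) ^ k * w 0)"
    using four by (intro sum_mono) auto
  also have "\<dots> = (\<Sum>k\<le>p. (1 / 2) ^ k) * w 0" by (simp add: sum_distrib_right)
  also have "\<dots> \<le> 2 * w 0" using geo w0 by (rule mult_right_mono)
  finally have all: "(\<Sum>k\<le>p. w k * 4 ^ k) \<le> 2 * w 0" .
  have "(\<Sum>k\<le>p. w k) \<le> (\<Sum>k\<le>p. w k * 4 ^ k)"
  proof (rule sum_mono)
    fix k assume "k \<in> {..p}"
    then show "w k \<le> w k * 4 ^ k"
      using w(1)[of k] mult_left_mono[of 1 "4 ^ k" "w k"] by simp
  qed
  then show "w 0 \<ge> 1 / 2" using all w by simp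
  have "w 0 \<le> (\<Sum>k\<le>p. w k)" using w(1) by (intro member_le_sum) auto
  then show "(\<Sum>k\<le>p. w k * 4 ^ k) \<le> 2" using all w by simp
qed

lemma rate_lower_bound:
  assumes "p \<ge> 2" "s \<ge> 1"
  shows "ln 2 powr max (d - 1) 1 \<le> rate d n p m s"
proof -
  let ?V = "max (ln (real p) powr max (d - 1) 1) (ln (1 + real m / real n))"
  have "ln 2 powr max (d - 1) 1 \<le> ln (real p) powr max (d - 1) 1"
    using assms by (intro powr_mono2) auto
  also have "\<dots> \<le> 1 * ?V" by simp
  also have "\<dots> \<le> real s * ?V"
    using assms by (intro mult_right_mono) (auto simp: le_max_iff_disj)
  finally show ?thesis by (simp add: rate_def)
qed

theorem theorem7:
  fixes A1 A2 A3 A4 b d K :: real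
  assumes "A1 > 0" "A2 > 0" "A3 > 0" "A4 > 2"
    and "0 < b" "b < 1" "d > 0" "K > 0"
  shows "\<exists>M>0. \<forall>c0>0. \<exists>C1>0. \<exists>C2>0.
    \<forall>(p :: nat \<Rightarrow> nat) (m :: nat \<Rightarrow> nat) (s :: nat \<Rightarrow> nat)
      (w :: nat \<Rightarrow> nat \<Rightarrow> real) (X :: nat \<Rightarrow> real mat) (Xt :: nat \<Rightarrow> real mat) (lam :: nat \<Rightarrow> real).
      (\<forall>n\<ge>1. p n > n \<and> m n \<ge> 1 \<and> 1 \<le> s n \<and> s n \<le> n \<and>
         X n \<in> carrier_mat n (p n) \<and> Xt n \<in> carrier_mat (m n) (p n) \<and>
         (\<forall>j<p n. col_norm (X n) j = sqrt (real n)) \<and>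
         (\<forall>j<p n. col_norm (Xt n) j = sqrt (real (m n))) \<and>
         lam n = sqrt (real n) / real (p n) \<and>
         (\<forall>k\<le>p n. w n k \<ge> 0) \<and> (\<Sum>k\<le>p n. w n k) = 1 \<and>
         (\<forall>k\<in>{1..p n}. A1 * real (p n) powr (- A3) * w n (k - 1) \<le> w n k \<and>
                        w n k \<le> A2 * real (p n) powr (- A4) * w n (k - 1))) \<and>
      (\<lambda>n. real n) \<in> o(\<lambda>n. real (p n) / sqrt (ln (real (p n)))) \<longrightarrow>
      (\<forall>n\<ge>1. (SUP \<beta>0\<in>param_set b d K A4 (lam n) M c0 (X n) (s n).
                 (tv_risk (X n) (Xt n) (spike_slab (p n) (lam n) (w n)) \<beta>0)\<^sup>2)
               \<le> ennreal (C1 * rate d n (p n) (m n) (s n))) \<and>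
      (\<lambda>n. SUP \<beta>0\<in>param_set b d K A4 (lam n) M c0 (X n) (s n).
             emeasure (model (X n) \<beta>0)
               {Y \<in> space (model (X n) \<beta>0).
                  kl_loss (X n) (Xt n) (spike_slab (p n) (lam n) (w n)) \<beta>0 Y
                    \<ge> ereal (C2 * rate d n (p n) (m n) (s n))})
        \<longlonglongrightarrow> 0"
proof (rule exI[of _ 1], intro conjI allI impI)
  fix c0 :: real
  assume c0: "0 < c0"
  define C1 where "C1 = 1 / ln 2 powr max (d - 1) 1"
  define C2 where "C2 = \<bar>ln A1\<bar> + A3 + 17 + 8 / c0\<^sup>2"
  have C1: "C1 > 0" by (simp add: C1_def)
  have C2: "C2 > 0" using assms by (simp add: C2_def add_pos_nonneg)
  show "\<exists>C1>0. \<exists>C2>0.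
    \<forall>(p :: nat \<Rightarrow> nat) (m :: nat \<Rightarrow> nat) (s :: nat \<Rightarrow> nat)
      (w :: nat \<Rightarrow> nat \<Rightarrow> real) (X :: nat \<Rightarrow> real mat) (Xt :: nat \<Rightarrow> real mat) (lam :: nat \<Rightarrow> real).
      (\<forall>n\<ge>1. p n > n \<and> m n \<ge> 1 \<and> 1 \<le> s n \<and> s n \<le> n \<and>
         X n \<in> carrier_mat n (p n) \<and> Xt n \<in> carrier_mat (m n) (p n) \<and>
         (\<forall>j<p n. col_norm (X n) j = sqrt (real n)) \<and>
         (\<forall>j<p n. col_norm (Xt n) j = sqrt (real (m n))) \<and>
         lam n = sqrt (real n) / real (p n) \<and>
         (\<forall>k\<le>p n. w n k \<ge> 0) \<and> (\<Sum>k\<le>p n. w n k) = 1 \<and>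
         (\<forall>k\<in>{1..p n}. A1 * real (p n) powr (- A3) * w n (k - 1) \<le> w n k \<and>
                        w n k \<le> A2 * real (p n) powr (- A4) * w n (k - 1))) \<and>
      (\<lambda>n. real n) \<in> o(\<lambda>n. real (p n) / sqrt (ln (real (p n)))) \<longrightarrow>
      (\<forall>n\<ge>1. (SUP \<beta>0\<in>param_set b d K A4 (lam n) 1 c0 (X n) (s n).
                 (tv_risk (X n) (Xt n) (spike_slab (p n) (lam n) (w n)) \<beta>0)\<^sup>2)
               \<le> ennreal (C1 * rate d n (p n) (m n) (s n))) \<and>
      (\<lambda>n. SUP \<beta>0\<in>param_set b d K A4 (lam n) 1 c0 (X n) (s n).
             emeasure (model (X n) \<beta>0)
               {Y \<in> space (model (X n) \<beta>0).
                  kl_loss (X n) (Xt n) (spike_slab (p n) (lam n) (w n)) \<beta>0 Y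
                    \<ge> ereal (C2 * rate d n (p n) (m n) (s n))})
        \<longlonglongrightarrow> 0"
  proof (rule exI[of _ C1], rule conjI[OF C1], rule exI[of _ C2], rule conjI[OF C2],
      intro allI impI conjI, goal_cases)
    case (1 p m s w X Xt lam n)
    then have h: "n < p n" "1 \<le> s n" "X n \<in> carrier_mat n (p n)" "Xt n \<in> carrier_mat (m n) (p n)"
      by auto
    have "ln 2 powr max (d - 1) 1 \<le> rate d n (p n) (m n) (s n)"
      using h 1 by (intro rate_lower_bound) auto
    then have r: "1 \<le> C1 * rate d n (p n) (m n) (s n)"
      by (simp add: C1_def)
    show ?case
    proof (rule SUP_least)
      fix \<beta>0
      have "tv_risk (X n) (Xt n) (spike_slab (p n) (lam n) (w n)) \<beta>0 \<le> 1"
        using h by (intro tv_risk_le_1[where p = "p n"]) auto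
      then have "(tv_risk (X n) (Xt n) (spike_slab (p n) (lam n) (w n)) \<beta>0)\<^sup>2 \<le> 1\<^sup>2"
        by (intro power_mono) auto
      also have "\<dots> \<le> ennreal (C1 * rate d n (p n) (m n) (s n))"
        using ennreal_leI[OF r] by simp
      finally show "(tv_risk (X n) (Xt n) (spike_slab (p n) (lam n) (w n)) \<beta>0)\<^sup>2 \<le> \<dots>" .
    qed
  next
    case (2 p m s w X Xt lam)
    define q where "q n = (SUP \<beta>0\<in>param_set b d K A4 (lam n) 1 c0 (X n) (s n).
             emeasure (model (X n) \<beta>0)
               {Y \<in> space (model (X n) \<beta>0).
                  kl_loss (X n) (Xt n) (spike_slab (p n) (lam n) (w n)) \<beta>0 Y
                    \<ge> ereal (C2 * rate d n (p n) (m n) (s n))})" for n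
    \<comment> \<open>From this sample size on, \<open>ln p \<ge> 1\<close> and the size distribution decays with ratio at most \<open>1 / 8\<close>.\<close>
    have bound: "q n \<le> ennreal (4 / real n)" if n3: "n \<ge> 3" and nA: "real n \<ge> 8 * A2" for n
    proof -
      from n3 have n1: "n \<ge> 1" by simp
      with 2 have h: "n < p n" "1 \<le> m n" "1 \<le> s n" "X n \<in> carrier_mat n (p n)" "Xt n \<in> carrier_mat (m n) (p n)"
        "\<And>j. j < p n \<Longrightarrow> col_norm (X n) j = sqrt (real n)"
        "\<And>j. j < p n \<Longrightarrow> col_norm (Xt n) j = sqrt (real (m n))"
        "lam n = sqrt (real n) / real (p n)"
        "\<And>k. k \<le> p n \<Longrightarrow> 0 \<le> w n k" "(\<Sum>k\<le>p n. w n k) = 1"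
        "\<And>k. k \<in> {1..p n} \<Longrightarrow> A1 * real (p n) powr (- A3) * w n (k - 1) \<le> w n k"
        "\<And>k. k \<in> {1..p n} \<Longrightarrow> w n k \<le> (A2 * real (p n) powr (- A4)) * w n (k - 1)"
        by auto
      have p3: "real (p n) \<ge> 3" "real (p n) \<ge> 8 * A2" using h(1) n3 nA by auto
      have lnp: "ln (real (p n)) \<ge> 1"
      proof -
        have "exp 1 \<le> real (p n)" using exp_le p3 by linarith
        then have "ln (exp 1) \<le> ln (real (p n))" using p3 by (subst ln_le_cancel_iff) auto
        then show ?thesis by simp
      qed
      have "real (p n) powr (- A4) \<le> real (p n) powr (- 1)"
        using p3 assms by (intro powr_mono) auto
      then have "A2 * real (p n) powr (- A4) \<le> A2 * (1 / real (p n))"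
        using assms p3 by (intro mult_left_mono) (auto simp: powr_minus_divide)
      also have "\<dots> \<le> 1 / 8" using p3 by (simp add: field_simps)
      finally have ratio: "A2 * real (p n) powr (- A4) \<le> 1 / 8" .
      have ratio0: "0 \<le> A2 * real (p n) powr (- A4)" using assms by simp
      note decay = prior_decay[OF h(9,10,12) ratio0 ratio]
      define V where "V = max (ln (real (p n)) powr max (d - 1) 1) (ln (1 + real (m n) / real n))"
      have V: "ln (real (p n)) \<le> V" "ln (1 + real (m n) / real n) \<le> V"
      proof -
        have "ln (real (p n)) powr 1 \<le> ln (real (p n)) powr max (d - 1) 1"
          using lnp by (intro powr_mono) auto
        then show "ln (real (p n)) \<le> V" using lnp by (simp add: V_def)
      qed (simp add: V_def)
      have "q n \<le> ennreal (4 / real (p n))"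
        unfolding q_def
      proof (rule SUP_least)
        fix \<beta>0 assume \<beta>0: "\<beta>0 \<in> param_set b d K A4 (lam n) 1 c0 (X n) (s n)"
        then have cc: "ereal c0 \<le> compat (X n) (supp (X n) \<beta>0)" and card: "card (supp (X n) \<beta>0) \<le> s n"
          by (auto simp: param_set_def beta_min_class_def)
        interpret sparse_prediction "X n" n "p n" "lam n" "w n" \<beta>0 c0 "Xt n" "m n"
          using h c0 n1 lnp cc by unfold_locales auto
        show "emeasure (model (X n) \<beta>0) {Y \<in> space (model (X n) \<beta>0).
                  kl_loss (X n) (Xt n) (spike_slab (p n) (lam n) (w n)) \<beta>0 Y
                    \<ge> ereal (C2 * rate d n (p n) (m n) (s n))} \<le> ennreal (4 / real (p n))"
          using kl_loss_tail[OF card[folded S_def] h(3) V assms(1,3) decay(1) h(11) decay(2)]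
          by (simp add: C2_def rate_def V_def)
      qed
      also have "\<dots> \<le> ennreal (4 / real n)"
        using h(1) n1 by (intro ennreal_leI divide_left_mono) auto
      finally show ?thesis .
    qed
    have "q \<longlonglongrightarrow> 0"
    proof (rule tendsto_sandwich)
      show "\<forall>\<^sub>F n in sequentially. 0 \<le> q n" by simp
      show "\<forall>\<^sub>F n in sequentially. q n \<le> ennreal (4 / real n)"
        using eventually_ge_at_top[of "max 3 (nat \<lceil>8 * A2\<rceil>)"]
      proof eventually_elim
        case (elim n)
        then have "8 * A2 \<le> real n" by linarith
        with elim show ?case by (intro bound) auto
      qed
      have "(\<lambda>n. 4 / real n) \<longlonglongrightarrow> 0" by (rule lim_const_over_n)
      then show "(\<lambda>n. ennreal (4 / real n)) \<longlonglongrightarrow> 0"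
        using tendsto_ennrealI by fastforce
    qed simp
    then show ?case unfolding q_def .
  qed
qed simp

end
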